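(* Let $b\ge2$ be an integer. If $k,m,n$ are integers with $2\leq m<k$ and $G_k(m)<n<G_k(m+1)$, then $s_b(n)<J_{k,m}(n)$, where \[J_{k,m}(x)=\frac{H_k(m+1)-H_k(m)}{G_k(m+1)-G_k(m)}(x-G_k(m))+H_k(m).\]
   Context: Fix an integer $b\ge 2$. A base $b$ over-expansion of a positive integer $N$ is a word $d_kd_{k-1}\cdots d_0$ over $\{0,1,\ldots,b\}$ with $d_k\neq 0$ and $\sum_{i=0}^k d_ib^i=N$. For $n\ge 2$, $s_b(n)$ is the number of base $b$ over-expansions of $n-1$; $s_b(0)=0$, $s_b(1)=1$. The integers $h_m$ are defined by $h_1=h_2=1$ and, for $m\geq 3$, $h_m=1+\sum_{i=0}^{\lfloor (m-3)/2\rfloor}b^{m-2-2i}$. For integers $2\le m\le k$, $G_k(m)=b^k+h_m$ and $H_k(m)=F_{m+2}+(k-m)F_m$, where $F_j$ are the Fibonacci numbers with $F_1=F_2=1$. *)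

theory Defs
  imports Complex_Main "HOL-Number_Theory.Fib"
begin

text \<open>
  A word \<open>d\<^sub>k \<dots> d\<^sub>1 d\<^sub>0\<close> is represented by the list \<open>[d\<^sub>0, d\<^sub>1, \<dots>, d\<^sub>k]\<close>, so that \<open>ds ! i\<close> is
  the digit \<open>d\<^sub>i\<close> and \<open>last ds\<close> is the leading digit.
\<close>

definition over_expansions :: "nat \<Rightarrow> nat \<Rightarrow> nat list set" where
  "over_expansions b N =
     {ds. ds \<noteq> [] \<and> set ds \<subseteq> {0..b} \<and> last ds \<noteq> 0 \<and> (\<Sum>i<length ds. ds ! i * b ^ i) = N}"

definition s :: "nat \<Rightarrow> nat \<Rightarrow> nat" where
  "s b n = (if n = 0 then 0 else if n = 1 then 1 else card (over_expansions b (n - 1)))"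

text \<open>Only \<open>m \<ge> 1\<close> is meaningful in \<open>h\<close>; the value at \<open>m = 0\<close> is arbitrary.\<close>

definition h :: "nat \<Rightarrow> nat \<Rightarrow> nat" where
  "h b m = (if m \<le> 2 then 1 else 1 + (\<Sum>i = 0..(m - 3) div 2. b ^ (m - 2 - 2 * i)))"

definition G :: "nat \<Rightarrow> nat \<Rightarrow> nat \<Rightarrow> nat" where
  "G b k m = b ^ k + h b m"

text \<open>Only used for \<open>m \<le> k\<close>, where the subtraction does not truncate.\<close>

definition H :: "nat \<Rightarrow> nat \<Rightarrow> nat" where
  "H k m = fib (m + 2) + (k - m) * fib m"

definition J :: "nat \<Rightarrow> nat \<Rightarrow> nat \<Rightarrow> real \<Rightarrow> real" where
  "J b k m x =
     (real (H k (m + 1)) - real (H k m)) / (real (G b k (m + 1)) - real (G b k m))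
       * (x - real (G b k m)) + real (H k m)"

text \<open>The cardinality in \<open>s\<close> is a genuine count: \<open>card\<close> is not applied to an infinite set.\<close>

lemma finite_over_expansions:
  assumes "b \<ge> 2"
  shows "finite (over_expansions b N)"
proof (rule finite_subset)
  show "over_expansions b N \<subseteq> {ds. set ds \<subseteq> {0..b} \<and> length ds \<le> Suc N}"
  proof safe
    fix ds assume ds: "ds \<in> over_expansions b N"
    then show "x \<in> {0..b}" if "x \<in> set ds" for x
      using that by (auto simp: over_expansions_def)
    define k where "k = length ds - 1"
    have len: "length ds = Suc k" and nz: "ds ! k \<noteq> 0"
      using ds by (auto simp: over_expansions_def k_def last_conv_nth)
    have "k < 2 ^ k" by (rule less_exp)
    also have "\<dots> \<le> b ^ k" using assms by (rule power_mono) simp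
    also have "\<dots> \<le> ds ! k * b ^ k" using nz by simp
    also have "\<dots> \<le> (\<Sum>i<length ds. ds ! i * b ^ i)" using len by simp
    also have "\<dots> = N" using ds by (simp add: over_expansions_def)
    finally show "length ds \<le> Suc N" using len by simp
  qed
  show "finite {ds. set ds \<subseteq> {0..b} \<and> length ds \<le> Suc N}"
    by (rule finite_lists_length_le) simp
qed

end

theory Submission
  imports Defs
begin

text \<open>
  Let \<open>e(N)\<close> count the over-expansions of \<open>N\<close>, with \<open>e(0) = 1\<close>, so \<open>s(n) = e(n - 1)\<close>. Reading off the last
  digit gives \<open>e(bq + r) = e(q)\<close> for \<open>0 < r < b\<close> and \<open>e(bq) = e(q) + e(q - 1)\<close>. With \<open>k = m + K\<close>,
  \<open>E\<^sub>m(x) = e(b\<^sup>k + h\<^sub>m - 1 + x)\<close> and \<open>D\<^sub>m = h\<^sub>m\<^sub>+\<^sub>1 - h\<^sub>m\<close>, the claim says that \<open>E\<^sub>m\<close> lies strictly below the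
  chord from \<open>(0, H\<^sub>k(m))\<close> to \<open>(D\<^sub>m, H\<^sub>k(m + 1))\<close>, whose slope is \<open>K F\<^sub>m\<^sub>-\<^sub>1 / D\<^sub>m\<close>. The factor \<open>K\<close> is common
  to all levels, and the induction goes over \<open>m\<close> with \<open>K\<close> fixed.

  Since \<open>h\<^sub>m - 1\<close> is a multiple of \<open>b\<close>, it suffices to treat multiples of \<open>b\<close>, and the recursion applied
  twice leaves two families of points, with \<open>E\<^sub>m = E\<^sub>m\<^sub>-\<^sub>1(bu) + E\<^sub>m\<^sub>-\<^sub>2(u')\<close> where \<open>u'\<close> is \<open>u\<close> or a
  neighbour of \<open>u\<close>. Adding the two chord bounds is too weak for one of the families (which one depends on
  \<open>b\<close> and the parity of \<open>m\<close>). There one uses that if \<open>b\<close> does not divide \<open>u'\<close>, the bound at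
  \<open>u' - 1\<close> already holds at \<open>u'\<close>; and if \<open>b\<close> divides \<open>u'\<close>, one more step of the recursion gives
  \<open>E\<^sub>m = 2 E\<^sub>m\<^sub>-\<^sub>2(bw) + E\<^sub>m\<^sub>-\<^sub>3(w')\<close>, for which the chord bounds suffice. The only exceptions are
  \<open>x = 8\<close> and \<open>x = 16\<close> for \<open>b = 2\<close>, \<open>m = 6\<close>, where the bounds for \<open>E\<^sub>3(w')\<close> and \<open>E\<^sub>4(bw)\<close> are sharpened.
\<close>

subsection \<open>Counting over-expansions\<close>

text \<open>Unlike \<^const>\<open>over_expansions\<close>, this admits the empty word, so that \<open>0\<close> has exactly one expansion.\<close>

definition expansions :: "nat \<Rightarrow> nat \<Rightarrow> nat list set" where
  "expansions b N = {ds. set ds \<subseteq> {0..b} \<and> (ds = [] \<or> last ds \<noteq> 0) \<and> (\<Sum>i<length ds. ds ! i * b ^ i) = N}"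

definition expansion_count :: "nat \<Rightarrow> nat \<Rightarrow> nat" where
  "expansion_count b N = card (expansions b N)"

lemma expansions_pos: "N > 0 \<Longrightarrow> expansions b N = over_expansions b N"
  unfolding expansions_def over_expansions_def by auto

lemma Nil_in_expansions_iff: "[] \<in> expansions b N \<longleftrightarrow> N = 0"
  by (auto simp: expansions_def)

text \<open>The prepended digit is the lowest one, so it can violate the leading-digit condition
  only in front of the empty word.\<close>

lemma Cons_in_expansions_iff:
  "d # ds \<in> expansions b N \<longleftrightarrow>
     d \<le> b \<and> (ds = [] \<longrightarrow> d \<noteq> 0) \<and> (\<exists>q. ds \<in> expansions b q \<and> N = d + b * q)"
proof -
  have "(\<Sum>i<length (d # ds). (d # ds) ! i * b ^ i) = d + b * (\<Sum>i<length ds. ds ! i * b ^ i)"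
    by (simp add: sum.lessThan_Suc_shift sum_distrib_left mult_ac del: sum.lessThan_Suc)
  then show ?thesis
    by (auto simp: expansions_def)
qed

lemma expansions_0: assumes "b \<ge> 1" shows "expansions b 0 = {[]}"
proof -
  have "ds \<in> expansions b 0 \<Longrightarrow> ds = []" for ds
  proof (induction ds)
    case (Cons d ds)
    then show ?case using assms by (auto simp: Cons_in_expansions_iff)
  qed simp
  then show ?thesis by (auto simp: Nil_in_expansions_iff)
qed

lemma finite_expansions: "b \<ge> 2 \<Longrightarrow> finite (expansions b N)"
  by (cases "N = 0") (auto simp: expansions_0 expansions_pos finite_over_expansions)

lemma s_eq_expansion_count: "b \<ge> 2 \<Longrightarrow> n > 0 \<Longrightarrow> s b n = expansion_count b (n - 1)"
  by (auto simp: s_def expansion_count_def expansions_0 expansions_pos)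

text \<open>The residue of the number modulo \<open>b\<close> determines the lowest digit, except
  that residue 0 allows both 0 and \<open>b\<close>. Hence nothing branches for
  \<open>0 < r < b\<close>.\<close>

lemma expansion_count_add:
  assumes "0 < r" "r < b"
  shows "expansion_count b (b * q + r) = expansion_count b q"
proof -
  have "expansions b (b * q + r) = Cons r ` expansions b q"
  proof (intro equalityI subsetI)
    fix ds assume ds: "ds \<in> expansions b (b * q + r)"
    then obtain d es where [simp]: "ds = d # es"
      using assms by (cases ds) (auto simp: Nil_in_expansions_iff)
    obtain q' where q': "d \<le> b" "es \<in> expansions b q'" "b * q + r = d + b * q'"
      using ds by (auto simp: Cons_in_expansions_iff)
    have "(b * q + r) mod b = (d + b * q') mod b" using q' by simp
    then have m: "d mod b = r" using assms by simp
    have "d \<noteq> b" using m assms by auto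
    then have "d = r" using m q'(1) by simp
    then show "ds \<in> Cons r ` expansions b q" using q' assms by auto
  qed (use assms in \<open>auto simp: Cons_in_expansions_iff\<close>)
  then show ?thesis
    unfolding expansion_count_def by (simp add: card_image)
qed

text \<open>Residue 0 is the only source of branching: lowest digit 0 leaves \<open>Suc q\<close>,
  lowest digit \<open>b\<close> leaves \<open>q\<close>. The quotient is a successor because 0 has
  only the empty expansion and no left neighbour.\<close>

lemma expansion_count_mult:
  assumes "b \<ge> 2"
  shows "expansion_count b (b * Suc q) = expansion_count b (Suc q) + expansion_count b q"
proof -
  have eq: "expansions b (b * Suc q) = Cons 0 ` expansions b (Suc q) \<union> Cons b ` expansions b q"
  proof (intro equalityI subsetI)
    fix ds assume ds: "ds \<in> expansions b (b * Suc q)"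
    then obtain d es where [simp]: "ds = d # es"
      using assms by (cases ds) (auto simp: Nil_in_expansions_iff)
    obtain q' where q': "d \<le> b" "es \<in> expansions b q'" "b * Suc q = d + b * q'"
      using ds by (auto simp: Cons_in_expansions_iff)
    have "(b * Suc q) mod b = (d + b * q') mod b" using q' by simp
    then have "d mod b = 0" by simp
    then have "d = 0 \<or> d = b" using q'(1) assms by (metis le_neq_implies_less mod_less)
    then show "ds \<in> Cons 0 ` expansions b (Suc q) \<union> Cons b ` expansions b q"
    proof
      assume "d = 0"
      then have "q' = Suc q" using q'(3) assms by (simp del: mult_Suc_right)
      then show ?thesis using q' \<open>d = 0\<close> by auto
    next
      assume "d = b"
      then show ?thesis using q' assms by auto
    qed
  next
    fix ds assume "ds \<in> Cons 0 ` expansions b (Suc q) \<union> Cons b ` expansions b q"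
    then show "ds \<in> expansions b (b * Suc q)"
      using assms by (fastforce simp: Cons_in_expansions_iff Nil_in_expansions_iff)
  qed
  show ?thesis
    unfolding expansion_count_def eq
    using assms by (subst card_Un_disjoint) (auto simp: card_image finite_expansions)
qed

text \<open>For \<open>r > 0\<close> and \<open>q > 0\<close> the left side is \<open>e(q)\<close>
  and the right side \<open>e(q) + e(q - 1)\<close>; for \<open>q = 0\<close> both are 1.\<close>

lemma expansion_count_add_le:
  assumes "b \<ge> 2" "r < b"
  shows "expansion_count b (b * q + r) \<le> expansion_count b (b * q)"
proof (cases "r = 0")
  case False
  then show ?thesis
    using assms expansion_count_add[of r b q] expansion_count_mult[of b "q - 1"]
    by (cases q) auto
qed simp

text \<open>In the ordinary base \<open>b\<close> expansion all digits are \<open>b - 1\<close>, so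
  peeling off residues never branches.\<close>

lemma expansion_count_pred_power:
  assumes "b \<ge> 2"
  shows "expansion_count b (b ^ k - 1) = 1"
proof (induction k)
  case 0
  show ?case using assms by (simp add: expansion_count_def expansions_0)
next
  case (Suc k)
  have "b ^ k \<ge> 1" using assms by simp
  then have "b ^ Suc k - 1 = b * (b ^ k - 1) + (b - 1)"
    using assms by (auto simp: algebra_simps)
  then show ?case
    using Suc expansion_count_add[of "b - 1" b "b ^ k - 1"] assms by simp
qed

text \<open>Each further factor \<open>b\<close> adds the count of the left neighbour
  \<open>b ^ k - 1\<close>, which is 1.\<close>

lemma expansion_count_power:
  assumes "b \<ge> 2"
  shows "expansion_count b (b ^ k) = k + 1"
proof (induction k)
  case 0
  then show ?case
    using assms expansion_count_add[of 1 b 0] by (simp add: expansion_count_def expansions_0)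
next
  case (Suc k)
  have "b ^ k = Suc (b ^ k - 1)" using assms by simp
  then have "b ^ Suc k = b * Suc (b ^ k - 1)" by simp
  then show ?case
    using Suc expansion_count_mult[OF assms, of "b ^ k - 1"] expansion_count_pred_power[OF assms] assms
    by simp
qed

subsection \<open>The offsets and their gaps\<close>

definition offset :: "nat \<Rightarrow> nat \<Rightarrow> nat" where
  "offset b m = h b m - 1"

text \<open>The horizontal length of the chord at level \<open>m\<close>. By
  \<open>offset_Suc_gap\<close> the subtraction does not truncate.\<close>

definition gap :: "nat \<Rightarrow> nat \<Rightarrow> nat" where
  "gap b m = offset b (Suc m) - offset b m"

lemma h_eq_offset: "h b m = Suc (offset b m)"
  by (simp add: offset_def h_def)

lemma offset_1_2 [simp]: "offset b (Suc 0) = 0" "offset b 2 = 0"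
  by (simp_all add: offset_def h_def)

lemma offset_add_2:
  assumes "m \<ge> 1"
  shows "offset b (m + 2) = b ^ m + offset b m"
proof (cases "m \<le> 2")
  case True
  then have "m = 1 \<or> m = 2" using assms by auto
  then show ?thesis by (auto simp: offset_def h_def)
next
  case False
  then obtain l where l: "m = l + 3" by (metis add.commute le_Suc_ex not_less_eq_eq numeral_2_eq_2 numeral_3_eq_3)
  have "(\<Sum>i = 0..Suc (l div 2). b ^ (m - 2 * i)) = b ^ m + (\<Sum>i = 0..l div 2. b ^ (m - 2 * Suc i))"
    by (subst sum.atLeast0_atMost_Suc_shift) simp
  then show ?thesis using l by (simp add: offset_def h_def add.commute)
qed

text \<open>From \<open>m = 3\<close> on, the exponents in \<open>offset b m\<close> descend in
  steps of 2 to 1 for odd \<open>m\<close> and to 2 for even \<open>m\<close>. Multiplication by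
  \<open>b\<close> therefore misses the term \<open>b\<close> exactly for even \<open>m\<close>;
  this is the origin of all parity distinctions below.\<close>

lemma offset_Suc:
  assumes "m \<ge> 1"
  shows "offset b (Suc m) = b * offset b m + (if even m then b else 0)"
  using assms
proof (induction m rule: less_induct)
  case (less m)
  show ?case
  proof (cases "m \<le> 2")
    case True
    then have "m = 1 \<or> m = 2" using less by auto
    then show ?thesis
      using offset_add_2[of 1 b] by (auto simp: numeral_2_eq_2[symmetric] numeral_3_eq_3[symmetric])
  next
    case False
    then obtain l where l: "m = l + 2" "l \<ge> 1" by (metis add.commute le_Suc_ex nat_le_linear not_less_eq_eq One_nat_def Suc_1 add_2_eq_Suc)
    have "offset b (Suc m) = b ^ Suc l + offset b (Suc l)"
      using offset_add_2[of "Suc l" b] l by simp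
    then show ?thesis
      using less.IH[of l] l offset_add_2[of l b] by (simp add: algebra_simps)
  qed
qed

lemma offset_Suc_gap:
  assumes "b \<ge> 2" "m \<ge> 1"
  shows "offset b (Suc m) = offset b m + gap b m"
proof -
  have "offset b m \<le> b * offset b m" using assms by simp
  then have "offset b m \<le> offset b (Suc m)" using assms by (simp add: offset_Suc trans_le_add1)
  then show ?thesis by (simp add: gap_def)
qed

lemma gap_1 [simp]: "gap b (Suc 0) = 0"
  by (simp add: gap_def numeral_2_eq_2[symmetric])

lemma gap_Suc_odd:
  assumes "b \<ge> 2" "odd m"
  shows "gap b (Suc m) = b * gap b m + b"
proof -
  have m: "m \<ge> 1" using assms by (cases m) auto
  have "offset b (Suc (Suc m)) = b * offset b (Suc m) + b" "offset b (Suc m) = b * offset b m"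
    using m assms by (simp_all add: offset_Suc)
  moreover have "b * offset b (Suc m) = b * offset b m + b * gap b m"
    using offset_Suc_gap[OF assms(1) m] by (simp add: distrib_left)
  ultimately show ?thesis
    using offset_Suc_gap[OF assms(1), of "Suc m"] by simp
qed

text \<open>The correction by \<open>b\<close> is negative here, so it stands on the left to avoid
  truncated subtraction.\<close>

lemma gap_Suc_even:
  assumes "b \<ge> 2" "even m" "m \<ge> 1"
  shows "gap b (Suc m) + b = b * gap b m"
proof -
  have "offset b (Suc (Suc m)) = b * offset b (Suc m)" "offset b (Suc m) = b * offset b m + b"
    using assms by (simp_all add: offset_Suc)
  moreover have "b * offset b (Suc m) = b * offset b m + b * gap b m"
    using offset_Suc_gap[OF assms(1,3)] by (simp add: distrib_left)
  ultimately show ?thesis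
    using offset_Suc_gap[OF assms(1), of "Suc m"] by simp
qed

text \<open>Division by \<open>b\<close> lowers the exponent and the level together, so with the
  exponent written as \<open>m + K\<close> the recursion leaves \<open>K\<close> unchanged.\<close>

definition offset_count :: "nat \<Rightarrow> nat \<Rightarrow> nat \<Rightarrow> nat \<Rightarrow> nat" where
  "offset_count b K m x = expansion_count b (b ^ (m + K) + offset b m + x)"

section \<open>Recursions for \<open>offset_count\<close>\<close>

lemma offset_count_Suc_odd_mult:
  assumes "b \<ge> 2" "odd m"
  shows "offset_count b K (Suc m) (b * Suc x) = offset_count b K m (Suc x) + offset_count b K m x"
proof -
  have "m \<ge> 1" using assms by (cases m) auto
  then have e: "b ^ (Suc m + K) + offset b (Suc m) + b * Suc x = b * Suc (b ^ (m + K) + offset b m + x)"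
    using assms by (simp add: offset_Suc algebra_simps)
  show ?thesis
    unfolding offset_count_def e expansion_count_mult[OF assms(1)] by simp
qed

lemma offset_count_Suc_odd_add:
  assumes "odd m" "0 < r" "r < b"
  shows "offset_count b K (Suc m) (b * x + r) = offset_count b K m x"
proof -
  have "m \<ge> 1" using assms by (cases m) auto
  then have e: "b ^ (Suc m + K) + offset b (Suc m) + (b * x + r) = b * (b ^ (m + K) + offset b m + x) + r"
    using assms by (simp add: offset_Suc algebra_simps)
  show ?thesis
    unfolding offset_count_def e expansion_count_add[OF assms(2,3)] by simp
qed

lemma offset_count_Suc_even_mult:
  assumes "b \<ge> 2" "even m" "m \<ge> 1"
  shows "offset_count b K (Suc m) (b * x) = offset_count b K m (Suc x) + offset_count b K m x"
proof -
  have e: "b ^ (Suc m + K) + offset b (Suc m) + b * x = b * Suc (b ^ (m + K) + offset b m + x)"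
    using assms by (simp add: offset_Suc algebra_simps)
  show ?thesis
    unfolding offset_count_def e expansion_count_mult[OF assms(1)] by simp
qed

lemma offset_count_Suc_even_add:
  assumes "even m" "m \<ge> 1" "0 < r" "r < b"
  shows "offset_count b K (Suc m) (b * x + r) = offset_count b K m (Suc x)"
proof -
  have e: "b ^ (Suc m + K) + offset b (Suc m) + (b * x + r) = b * (b ^ (m + K) + offset b m + Suc x) + r"
    using assms by (simp add: offset_Suc algebra_simps)
  show ?thesis
    unfolding offset_count_def e expansion_count_add[OF assms(3,4)] by simp
qed

lemma offset_count_add_le:
  assumes "b \<ge> 2" "m \<ge> 1" "r < b"
  shows "offset_count b K m (b * x + r) \<le> offset_count b K m (b * x)"
proof -
  obtain l where l: "m = Suc l" using assms by (cases m) auto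
  have "b dvd offset b m"
    using l by (cases "l = 0") (auto simp: offset_Suc)
  then obtain c where c: "offset b m = b * c" by blast
  have e: "b ^ (m + K) + offset b m + (b * x + r) = b * (b ^ (l + K) + c + x) + r"
    "b ^ (m + K) + offset b m + b * x = b * (b ^ (l + K) + c + x)"
    using l c by (simp_all add: algebra_simps)
  show ?thesis
    unfolding offset_count_def e by (rule expansion_count_add_le[OF assms(1,3)])
qed

text \<open>The values satisfy the Fibonacci recursion in \<open>m\<close>: one branch stays at 0 on
  level \<open>m - 1\<close>, the other has nonzero residue and drops to 0 on level
  \<open>m - 2\<close>.\<close>

lemma offset_count_0:
  assumes "b \<ge> 2" "m \<ge> 1"
  shows "offset_count b K m 0 = fib (m + 2) + K * fib m"
  using assms(2)
proof (induction m rule: less_induct)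
  case (less m)
  have two: "offset_count b K 2 0 = 3 + K" for K
    using expansion_count_power[OF assms(1), of "Suc (Suc K)"] by (simp add: offset_count_def)
  consider "m = 1" | "m = 2" | "m = Suc (Suc (m - 2))" "m - 2 \<ge> 1"
    using less.prems by linarith
  then show ?case
  proof cases
    case 1
    then show ?thesis
      using expansion_count_power[OF assms(1), of "Suc K"] by (simp add: offset_count_def numeral_3_eq_3)
  next
    case 2
    then show ?thesis using two by (simp add: numeral_eq_Suc)
  next
    case m: 3
    define l where "l = m - 2"
    have 3: "m = Suc (Suc l)" "l \<ge> 1" using m unfolding l_def by simp_all
    have IH: "offset_count b K l 0 = fib (l + 2) + K * fib l" "offset_count b K (Suc l) 0 = fib (l + 3) + K * fib (Suc l)"
      using less.IH[of l] less.IH[of "Suc l"] 3 by (simp_all add: numeral_3_eq_3)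
    have "offset_count b K m 0 = offset_count b K (Suc l) 0 + offset_count b K l 0"
    proof (cases "even l")
      case True
      \<comment> \<open>The second branch lies at \<open>x = -1\<close>, outside the domain of
        \<open>offset_count\<close>, so it is treated through \<open>expansion_count\<close>; its
        residue is \<open>b - 1\<close>.\<close>
      define q where "q = b * (b ^ (l + K) + offset b l) + (b - 1)"
      have q: "b ^ (Suc l + K) + offset b (Suc l) = Suc q"
        using 3 True assms by (simp add: offset_Suc q_def algebra_simps)
      have "b ^ (m + K) + offset b m = b * (b ^ (Suc l + K) + offset b (Suc l))"
        using 3 True by (simp add: offset_Suc algebra_simps)
      then have "offset_count b K m 0 = expansion_count b (b * Suc q)"
        unfolding offset_count_def q by simp
      moreover have "expansion_count b q = offset_count b K l 0"
        unfolding q_def offset_count_def using assms by (subst expansion_count_add) auto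
      ultimately show ?thesis
        using q by (simp only: expansion_count_mult[OF assms(1)]) (simp add: offset_count_def)
    next
      case False
      then show ?thesis
        using 3 assms offset_count_Suc_even_mult[of b "Suc l" K 0] offset_count_Suc_odd_add[of l 1 b K 0] by simp
    qed
    then show ?thesis using IH 3 by (simp add: numeral_3_eq_3 algebra_simps)
  qed
qed

subsection \<open>Chords\<close>

text \<open>At \<open>m = 1\<close> the gap is \<open>0\<close>, the fraction is \<open>0\<close>, and the chord degenerates to the single point \<open>x = 0\<close>.\<close>

definition chord :: "nat \<Rightarrow> nat \<Rightarrow> nat \<Rightarrow> real \<Rightarrow> real" where
  "chord b K m x = real (fib (m + 2)) + real K * real (fib m)
     + real K * (real (fib (m - 1)) * x / real (gap b m))"

text \<open>Only interior points are included: at both ends the count meets the chord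
  (\<open>offset_count_at_0\<close>, \<open>offset_count_at_gap\<close>).\<close>

definition below_chord :: "nat \<Rightarrow> nat \<Rightarrow> nat \<Rightarrow> bool" where
  "below_chord b K m \<longleftrightarrow> (\<forall>x. 0 < x \<and> x < gap b m \<longrightarrow> real (offset_count b K m x) < chord b K m (real x))"

text \<open>Only a step from an even level subtracts \<open>b\<close>; together with the step before
  it, it still leaves at least \<open>b * b - b\<close>.\<close>

lemma gap_ge_2: "b \<ge> 2 \<Longrightarrow> m \<ge> 2 \<Longrightarrow> gap b m \<ge> 2"
proof (induction m rule: less_induct)
  case (less m)
  obtain l where l: "m = Suc l" "l \<ge> 1" using less.prems by (cases m) auto
  show ?case
  proof (cases "odd l")
    case True
    then show ?thesis using l less.prems by (simp add: gap_Suc_odd)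
  next
    case False
    then obtain j where j: "l = Suc j" "odd j" using l by (cases l) auto
    have "gap b m + b = b * (b * gap b j + b)"
      using gap_Suc_even[of b l] gap_Suc_odd[of b j] j l False less.prems by simp
    moreover have "b * (b * gap b j + b) \<ge> b * b" by simp
    moreover have "b * b \<ge> 2 * b" using less.prems by simp
    ultimately show ?thesis using less.prems by linarith
  qed
qed

lemma gap_le_Suc:
  assumes "b \<ge> 2" "1 \<le> m"
  shows "gap b m \<le> gap b (Suc m)"
proof (cases "odd m")
  case True
  then show ?thesis using assms by (simp add: gap_Suc_odd trans_le_add1)
next
  case False
  obtain a where a: "gap b m = a + 2" using gap_ge_2[of b m] assms False
    by (metis Suc_1 add.commute even_numeral le_Suc_ex le_antisym not_less_eq_eq odd_one One_nat_def)
  have "b * gap b m = b * a + 2 * b" using a by (simp add: algebra_simps)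
  moreover have "b * a \<ge> a" using assms by simp
  ultimately show ?thesis using gap_Suc_even[of b m] assms False a by linarith
qed

lemma gap_mono:
  assumes "m \<le> n" "b \<ge> 2" "1 \<le> m"
  shows "gap b m \<le> gap b n"
  using assms(1)
proof (induction n rule: dec_induct)
  case (step n)
  then show ?case using gap_le_Suc[of b n] assms by simp
qed simp

lemma gap_2: "b \<ge> 2 \<Longrightarrow> gap b 2 = b"
  using gap_Suc_odd[of b 1] by (simp add: numeral_2_eq_2)

lemma gap_3: "b \<ge> 2 \<Longrightarrow> gap b 3 + b = b * b"
  using gap_Suc_even[of b 2] gap_2[of b] by simp

lemma gap_4: "b \<ge> 2 \<Longrightarrow> gap b 4 = b * gap b 3 + b"
  using gap_Suc_odd[of b 3] by simp

lemma gap_5: "b \<ge> 2 \<Longrightarrow> gap b 5 + b = b * gap b 4"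
  using gap_Suc_even[of b 4] by simp

lemma chord_mono:
  assumes "x \<le> y"
  shows "chord b K m x \<le> chord b K m y"
  unfolding chord_def using assms by (intro add_left_mono mult_left_mono divide_right_mono) auto

lemma chord_strict_mono:
  assumes "b \<ge> 2" "m \<ge> 2" "K \<ge> 1" "x < y"
  shows "chord b K m x < chord b K m y"
proof -
  have "fib (m - 1) > 0" using assms by (simp add: fib_neq_0_nat)
  moreover have "gap b m > 0" using gap_ge_2[OF assms(1,2)] by simp
  ultimately show ?thesis
    unfolding chord_def using assms
    by (intro add_strict_left_mono mult_strict_left_mono divide_strict_right_mono) auto
qed

lemma offset_count_at_0: "b \<ge> 2 \<Longrightarrow> m \<ge> 1 \<Longrightarrow> real (offset_count b K m 0) = chord b K m 0"
  by (simp add: offset_count_0 chord_def)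

text \<open>With the exponent \<open>m + K\<close> fixed, the right end of level \<open>m\<close> is
  the left end of level \<open>m + 1\<close> for \<open>K - 1\<close>. This is where
  \<open>K\<close> must be positive.\<close>

lemma offset_count_at_gap:
  assumes "b \<ge> 2" "m \<ge> 1" "K \<ge> 1"
  shows "real (offset_count b K m (gap b m)) = chord b K m (real (gap b m))"
proof -
  obtain l where l: "m = Suc l" using assms by (cases m) auto
  obtain K' where K': "K = Suc K'" using assms by (cases K) auto
  have "offset_count b K m (gap b m) = offset_count b K' (Suc m) 0"
    using offset_Suc_gap[OF assms(1,2)] K' by (simp add: offset_count_def add.assoc)
  also have "\<dots> = fib (Suc m + 2) + K' * fib (Suc m)"
    using offset_count_0[OF assms(1), of "Suc m" K'] by simp
  \<comment> \<open>For \<open>m = 1\<close> the quotient in the chord is \<open>0 / 0 = 0\<close>,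
    consistent with \<open>fib 0 = 0\<close>.\<close>
  finally show ?thesis
    using gap_ge_2[of b m] assms l K'
    by (cases "l = 0") (auto simp: chord_def algebra_simps)
qed

lemma below_chordD_less:
  "below_chord b K m \<Longrightarrow> 0 < x \<Longrightarrow> x < gap b m \<Longrightarrow> real (offset_count b K m x) < chord b K m (real x)"
  by (simp add: below_chord_def)

lemma below_chordD:
  assumes "below_chord b K m" "b \<ge> 2" "m \<ge> 1" "K \<ge> 1" "x \<le> gap b m"
  shows "real (offset_count b K m x) \<le> chord b K m (real x)"
  using assms offset_count_at_0[of b m K] offset_count_at_gap[of b m K]
  unfolding below_chord_def by (cases "x = 0"; cases "x = gap b m") force+

text \<open>Rounding \<open>x\<close> down to a multiple of \<open>b\<close> does not decrease the
  count and moves left by at least 1.\<close>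

lemma below_chordD_not_dvd:
  assumes "below_chord b K m" "b \<ge> 2" "m \<ge> 1" "K \<ge> 1" "x \<le> gap b m" "\<not> b dvd x"
  shows "real (offset_count b K m x) \<le> chord b K m (real x - 1)"
proof -
  define y where "y = b * (x div b)"
  have x: "x = y + x mod b" by (simp add: y_def)
  have r: "x mod b > 0" using assms by (simp add: dvd_eq_mod_eq_0)
  have "offset_count b K m x \<le> offset_count b K m y"
    using offset_count_add_le[of b m "x mod b" K "x div b"] assms x y_def by simp
  then have "real (offset_count b K m x) \<le> chord b K m (real y)"
    using below_chordD[of b K m y] assms x by linarith
  also have "\<dots> \<le> chord b K m (real x - 1)"
    using x r by (intro chord_mono) linarith
  finally show ?thesis .
qed

text \<open>All \<open>offset b m\<close> are multiples of \<open>b\<close>, so passing from \<open>x\<close> to the next lower multiple of \<open>b\<close> does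
  not decrease the count, while it lowers the chord.\<close>

lemma below_chordI:
  assumes "b \<ge> 2" "m \<ge> 2" "K \<ge> 1"
    and *: "\<And>y. 0 < y \<Longrightarrow> b * y < gap b m \<Longrightarrow> real (offset_count b K m (b * y)) < chord b K m (real (b * y))"
  shows "below_chord b K m"
  unfolding below_chord_def
proof (intro allI impI)
  fix x assume x: "0 < x \<and> x < gap b m"
  define y where "y = x div b"
  have xy: "x = b * y + x mod b" by (simp add: y_def)
  have le: "offset_count b K m x \<le> offset_count b K m (b * y)"
    using offset_count_add_le[of b m "x mod b" K y] assms xy by simp
  have "real (b * y) \<le> real x" by (subst xy, subst of_nat_le_iff) simp
  then have cle: "chord b K m (real (b * y)) \<le> chord b K m (real x)" by (rule chord_mono)
  show "real (offset_count b K m x) < chord b K m (real x)"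
  proof (cases "y = 0")
    case True
    then show ?thesis
      using le offset_count_at_0[of b m K] chord_strict_mono[of b m K 0 "real x"] assms x by simp
  next
    case False
    moreover have "b * y < gap b m" using xy x by linarith
    ultimately have "real (offset_count b K m (b * y)) < chord b K m (real (b * y))" using * by simp
    moreover have "real (offset_count b K m x) \<le> real (offset_count b K m (b * y))" using le by simp
    ultimately show ?thesis using cle by (meson le_less_trans less_le_trans)
  qed
qed

section \<open>Levels 1 to 3\<close>

lemma below_chord_1: "below_chord b K (Suc 0)"
  by (simp add: below_chord_def)

text \<open>Since \<open>gap b 2 = b\<close>, no positive multiple of \<open>b\<close> lies in the
  interior.\<close>

lemma below_chord_2:
  assumes "b \<ge> 2" "K \<ge> 1" shows "below_chord b K 2"
proof (rule below_chordI[OF assms(1) _ assms(2)])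
  fix y assume "0 < y" "b * y < gap b 2"
  then show "real (offset_count b K 2 (b * y)) < chord b K 2 (real (b * y))"
    using gap_Suc_odd[of b 1] assms by (simp add: numeral_2_eq_2)
qed simp

text \<open>Since \<open>gap b 3 = b * b - b\<close>, both \<open>y\<close> and \<open>y + 1\<close>
  are below \<open>b\<close> and drop to 0 on level 1. The count is thus constantly
  \<open>4 + 2 K\<close>, while the chord starts at \<open>5 + 2 K\<close>.\<close>

lemma below_chord_3:
  assumes "b \<ge> 2" "K \<ge> 1" shows "below_chord b K 3"
proof (rule below_chordI[OF assms(1) _ assms(2)])
  fix y assume y: "0 < y" "b * y < gap b 3"
  note g = gap_3[OF assms(1)]
  have "b * Suc y < b * b" using y g by simp
  then have "Suc y < b" using mult_less_cancel1 by blast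
  then have "offset_count b K 2 (Suc y) = offset_count b K 1 0" "offset_count b K 2 y = offset_count b K 1 0"
    using offset_count_Suc_odd_add[of 1 "Suc y" b K 0] offset_count_Suc_odd_add[of 1 y b K 0] y by (simp_all add: numeral_2_eq_2)
  then have "offset_count b K 3 (b * y) = 2 * (2 + K)"
    using offset_count_Suc_even_mult[of b 2 K y] offset_count_0[of b 1 K] assms by (simp add: numeral_eq_Suc)
  moreover have "chord b K 3 (real (b * y)) \<ge> chord b K 3 0" by (rule chord_mono) simp
  moreover have "chord b K 3 0 = 5 + 2 * real K" by (simp add: chord_def numeral_eq_Suc)
  ultimately show "real (offset_count b K 3 (b * y)) < chord b K 3 (real (b * y))" by simp
qed simp

subsection \<open>Comparison of slopes\<close>

text \<open>These quotients stay below the inverse golden ratio 0.618..., hence below 5/8.\<close>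

lemma fib_ratio_upper: "8 * fib (2 * j) \<le> 5 * fib (Suc (2 * j))"
  by (induction j) auto

lemma fib_ratio_lower: "fib (Suc (2 * Suc j)) \<le> 2 * fib (2 * Suc j)"
  by simp

text \<open>Sharp at \<open>j = 0\<close>, where the quotient is 5/3.\<close>

lemma fib_ratio_lower': "3 * fib (Suc (2 * Suc (Suc j))) \<le> 5 * fib (2 * Suc (Suc j))"
  using fib_ratio_lower[of j] by simp

lemma add_divide_le:
  fixes X Y Z p q r :: real
  assumes "p > 0" "q > 0" "r > 0" "(X * q + Y * p) * r \<le> Z * (p * q)"
  shows "X / p + Y / q \<le> Z / r"
  using assms by (simp add: add_frac_eq frac_le_eq divide_le_0_iff mult.assoc)

lemma add_divide_less:
  fixes X Y Z p q r :: real
  assumes "p > 0" "q > 0" "r > 0" "(X * q + Y * p) * r < Z * (p * q)"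
  shows "X / p + Y / q < Z / r"
  using assms by (simp add: add_frac_eq frac_less_eq divide_less_0_iff mult.assoc)

text \<open>Here \<open>A\<close>, \<open>B\<close>, \<open>C\<close> stand for \<open>fib (q + 2)\<close>, \<open>fib (q + 1)\<close>, \<open>fib q\<close>, and \<open>d\<close> for \<open>gap b (q + 2)\<close>, where
  \<open>d = b (t + 1)\<close> for \<open>q\<close> even and \<open>d = b t\<close> for \<open>q\<close> odd; the fractions are chord slopes at levels \<open>q + 1\<close> to \<open>q + 4\<close>.\<close>

lemma slopes_even_1:
  fixes A B b d u :: real
  assumes "A * d \<le> B * (b - 1) * (d - 1)" "d > 1" "b \<ge> 1" "u \<ge> 0"
  shows "A * u / (d - 1) + B * u / d \<le> (A + B) * (b * u) / (b * d - b + 1)"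
proof (rule add_divide_le)
  have "b * (d - 1) \<ge> 0" using assms by simp
  then show "b * d - b + 1 > 0" by (simp add: algebra_simps)
  \<comment> \<open>Both sides are linear in \<open>u\<close> and vanish at 0, so clearing
    denominators leaves a multiple of \<open>u\<close>. Most of the following inequalities are
    equalities at 0 or at the far end and factor likewise.\<close>
  have "(A + B) * (b * u) * ((d - 1) * d) - (A * u * d + B * u * (d - 1)) * (b * d - b + 1)
      = u * (B * (b - 1) * (d - 1) - A * d)"
    by algebra
  also have "\<dots> \<ge> 0" using assms by simp
  finally show "(A * u * d + B * u * (d - 1)) * (b * d - b + 1) \<le> (A + B) * (b * u) * ((d - 1) * d)" by simp
qed (use assms in auto)

text \<open>For \<open>b = 2\<close> the condition of \<open>slopes_even_1\<close> would be
  \<open>A * d \<le> B * (d - 1)\<close>, which fails; the \<open>u - 1\<close> available for odd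
  \<open>u\<close> makes up for it.\<close>

lemma slopes_even_1_binary:
  fixes A B d u :: real
  assumes "8 * A \<le> 13 * B" "B \<le> A" "0 < B" "d \<ge> 2" "0 \<le> u" "u \<le> d - 1"
  shows "A * u / (d - 1) + B * (u - 1) / d < (A + B) * (2 * u) / (2 * d - 2 + 1)"
proof (rule add_divide_less)
  have "B * (d - 1) \<le> A * d" using assms by (intro mult_mono) auto
  \<comment> \<open>The coefficient of \<open>u\<close> is nonnegative, so \<open>u = d - 1\<close>
    is the critical case.\<close>
  then have "u * (A * d - B * (d - 1)) \<le> (d - 1) * (A * d - B * (d - 1))"
    using assms by (intro mult_right_mono) auto
  also have "\<dots> < (d - 1) * (B * (2 * d - 1))"
  proof (rule mult_strict_left_mono)
    have "8 * A * d \<le> 13 * B * d" using assms by (intro mult_right_mono) auto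
    then have "8 * (A * d) \<le> 13 * (B * d)" by simp
    moreover have "2 * B \<le> B * d" using assms by simp
    ultimately have "A * d < 3 * (B * d) - 2 * B" using assms(3) by linarith
    then show "A * d - B * (d - 1) < B * (2 * d - 1)" by (simp add: algebra_simps)
  qed (use assms in auto)
  finally have "u * (A * d - B * (d - 1)) < (d - 1) * (B * (2 * d - 1))" .
  moreover have "(A + B) * (2 * u) * ((d - 1) * d) - (A * u * d + B * (u - 1) * (d - 1)) * (2 * d - 2 + 1)
      = (d - 1) * (B * (2 * d - 1)) - u * (A * d - B * (d - 1))"
    by algebra
  ultimately show "(A * u * d + B * (u - 1) * (d - 1)) * (2 * d - 2 + 1) < (A + B) * (2 * u) * ((d - 1) * d)"
    by linarith
qed (use assms in auto)

lemma slopes_even_1_binary_dvd: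
  fixes B C t w :: real
  assumes "3 * C * (t + 1) \<le> 2 * B * t" "t > 0" "w \<ge> 0"
  shows "2 * B * w / (t + 1) + C * w / t \<le> (2 * B + C) * (4 * w) / (4 * t + 3)"
proof (rule add_divide_le)
  have "(2 * B + C) * (4 * w) * ((t + 1) * t) - (2 * B * w * t + C * w * (t + 1)) * (4 * t + 3)
     = w * (2 * B * t - 3 * C * (t + 1))" by algebra
  also have "\<dots> \<ge> 0" using assms by simp
  finally show "(2 * B * w * t + C * w * (t + 1)) * (4 * t + 3) \<le> (2 * B + C) * (4 * w) * ((t + 1) * t)" by simp
qed (use assms in auto)

text \<open>The term with \<open>B u\<close> comes from the bound at \<open>u\<close>, which holds
  at \<open>u + 1\<close> when \<open>b\<close> does not divide \<open>u + 1\<close>.\<close>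

lemma slopes_even_2:
  fixes A B b d u :: real
  assumes "A > 0" "B > 0" "d > 1" "b \<ge> 1" "0 \<le> u" "u \<le> d - 1"
  shows "A * u / (d - 1) + B * u / d < (A + B) * (b * u + 1) / (b * d - b + 1)"
proof (rule add_divide_less)
  have "b * (d - 1) \<ge> 0" using assms by simp
  then show "b * d - b + 1 > 0" by (simp add: algebra_simps)
  have "0 < B * (d - 1) * d + (d - 1 - u) * (A * d) + u * (B * (b - 1) * (d - 1))"
    using assms by (intro add_pos_nonneg mult_nonneg_nonneg mult_pos_pos) auto
  also have "\<dots> = (A + B) * (b * u + 1) * ((d - 1) * d) - (A * u * d + B * u * (d - 1)) * (b * d - b + 1)"
    by algebra
  finally show "(A * u * d + B * u * (d - 1)) * (b * d - b + 1) < (A + B) * (b * u + 1) * ((d - 1) * d)" by simp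
qed (use assms in auto)

text \<open>For \<open>b = 2\<close> the plain chord bound at \<open>u + 1\<close> suffices,
  divisible or not; at \<open>u = d - 1\<close> both sides equal \<open>A + B\<close>.\<close>

lemma slopes_even_2_binary:
  fixes A B d u :: real
  assumes "B \<le> A" "B \<ge> 0" "d > 1" "u \<le> d - 1"
  shows "A * u / (d - 1) + B * (u + 1) / d \<le> (A + B) * (2 * u + 1) / (2 * d - 2 + 1)"
proof (rule add_divide_le)
  have "B * (d - 1) \<le> A * d" using assms by (intro mult_mono) auto
  then have "0 \<le> (d - 1 - u) * (A * d - B * (d - 1))" using assms by simp
  also have "\<dots> = (A + B) * (2 * u + 1) * ((d - 1) * d) - (A * u * d + B * (u + 1) * (d - 1)) * (2 * d - 2 + 1)"
    by algebra
  finally show "(A * u * d + B * (u + 1) * (d - 1)) * (2 * d - 2 + 1) \<le> (A + B) * (2 * u + 1) * ((d - 1) * d)" by simp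
qed (use assms in auto)

lemma slopes_even_2_dvd:
  fixes B C b t w :: real
  assumes "2 * B * (b - 1) * t \<le> C * (b\<^sup>2 - b + 1) * (t + 1)" "t > 0" "b \<ge> 1" "w \<le> t + 1"
  shows "2 * B * w / (t + 1) + C * (w - 1) / t \<le> (2 * B + C) * (b\<^sup>2 * w - b + 1) / (b\<^sup>2 * (t + 1) - b + 1)"
proof (rule add_divide_le)
  have "b * 1 \<le> b * (b * (t + 1))" using assms mult_mono[of 1 b 1 "t + 1"] by (intro mult_left_mono) auto
  then show "b\<^sup>2 * (t + 1) - b + 1 > 0" by (simp add: power2_eq_square mult.assoc)
  have "(2 * B + C) * (b\<^sup>2 * w - b + 1) * ((t + 1) * t)
      - (2 * B * w * t + C * (w - 1) * (t + 1)) * (b\<^sup>2 * (t + 1) - b + 1)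
     = (t + 1 - w) * (C * (b\<^sup>2 - b + 1) * (t + 1) - 2 * B * (b - 1) * t)" by algebra
  also have "\<dots> \<ge> 0" using assms by simp
  finally show "(2 * B * w * t + C * (w - 1) * (t + 1)) * (b\<^sup>2 * (t + 1) - b + 1)
     \<le> (2 * B + C) * (b\<^sup>2 * w - b + 1) * ((t + 1) * t)" by simp
qed (use assms in auto)

lemma slopes_odd_1:
  fixes A B b d v :: real
  assumes "A * d \<le> B * (b - 1) * (d + 1)" "d > 0" "b \<ge> 1" "v \<le> d + 1"
  shows "A * v / (d + 1) + B * (v - 1) / d \<le> (A + B) * (b * v - 1) / (b * d + b - 1)"
proof (rule add_divide_le)
  have "b * d > 0" using assms by simp
  then show "b * d + b - 1 > 0" using assms by linarith
  have "(A + B) * (b * v - 1) * ((d + 1) * d) - (A * v * d + B * (v - 1) * (d + 1)) * (b * d + b - 1)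
      = (d + 1 - v) * (B * (b - 1) * (d + 1) - A * d)" by algebra
  also have "\<dots> \<ge> 0" using assms by simp
  finally show "(A * v * d + B * (v - 1) * (d + 1)) * (b * d + b - 1) \<le> (A + B) * (b * v - 1) * ((d + 1) * d)" by simp
qed (use assms in auto)

lemma slopes_odd_1_binary:
  fixes A B d v :: real
  assumes "A \<le> 2 * B" "0 \<le> B" "d \<ge> 1" "2 \<le> v" "v \<le> d + 1"
  shows "A * v / (d + 1) + B * (v - 2) / d \<le> (A + B) * (2 * v - 1) / (2 * d + 2 - 1)"
proof (rule add_divide_le)
  have "A * d \<le> 2 * B * d" using assms by (intro mult_right_mono) auto
  then have "A * d - B * (d + 1) \<le> B * (d - 1)" by (simp add: algebra_simps)
  then have "(d + 1 - v) * (A * d - B * (d + 1)) \<le> (d + 1 - v) * (B * (d - 1))"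
    using assms by (intro mult_left_mono) auto
  also have "\<dots> \<le> (2 * d + 1) * (B * (d + 1))"
    using assms by (intro mult_mono) auto
  finally have "0 \<le> (2 * d + 1) * (B * (d + 1)) - (d + 1 - v) * (A * d - B * (d + 1))" by simp
  also have "\<dots> = (A + B) * (2 * v - 1) * ((d + 1) * d) - (A * v * d + B * (v - 2) * (d + 1)) * (2 * d + 2 - 1)"
    by algebra
  finally show "(A * v * d + B * (v - 2) * (d + 1)) * (2 * d + 2 - 1) \<le> (A + B) * (2 * v - 1) * ((d + 1) * d)" by simp
qed (use assms in auto)

lemma slopes_odd_1_binary_dvd:
  fixes B C t w :: real
  assumes "3 * C * t \<le> 2 * B * (t + 1)" "t > 0" "w \<le> t"
  shows "2 * B * w / t + C * (w + 1) / (t + 1) \<le> (2 * B + C) * (4 * w + 1) / (4 * t + 1)"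
proof (rule add_divide_le)
  have "(2 * B + C) * (4 * w + 1) * (t * (t + 1)) - (2 * B * w * (t + 1) + C * (w + 1) * t) * (4 * t + 1)
     = (t - w) * (2 * B * (t + 1) - 3 * C * t)" by algebra
  also have "\<dots> \<ge> 0" using assms by simp
  finally show "(2 * B * w * (t + 1) + C * (w + 1) * t) * (4 * t + 1) \<le> (2 * B + C) * (4 * w + 1) * (t * (t + 1))" by simp
qed (use assms in auto)

lemma slopes_odd_2_binary:
  fixes A B d v :: real
  assumes "B * (d + 1) \<le> A * d" "d > 0" "v \<ge> 0"
  shows "A * v / (d + 1) + B * v / d \<le> (A + B) * (2 * v) / (2 * d + 2 - 1)"
proof (rule add_divide_le)
  have "(A + B) * (2 * v) * ((d + 1) * d) - (A * v * d + B * v * (d + 1)) * (2 * d + 2 - 1)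
     = v * (A * d - B * (d + 1))" by algebra
  also have "\<dots> \<ge> 0" using assms by simp
  finally show "(A * v * d + B * v * (d + 1)) * (2 * d + 2 - 1) \<le> (A + B) * (2 * v) * ((d + 1) * d)" by simp
qed (use assms in auto)

lemma slopes_odd_2_dvd:
  fixes B C b t w :: real
  assumes "2 * B * (b - 1) * (t + 1) \<le> C * (b\<^sup>2 - b + 1) * t" "t > 0" "b \<ge> 1" "w \<ge> 0"
  shows "2 * B * w / t + C * w / (t + 1) \<le> (2 * B + C) * (b\<^sup>2 * w) / (b\<^sup>2 * t + b - 1)"
proof (rule add_divide_le)
  have "b\<^sup>2 * t > 0" using assms by simp
  then show "b\<^sup>2 * t + b - 1 > 0" using assms by linarith
  have "(2 * B + C) * (b\<^sup>2 * w) * (t * (t + 1)) - (2 * B * w * (t + 1) + C * w * t) * (b\<^sup>2 * t + b - 1)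
     = w * (C * (b\<^sup>2 - b + 1) * t - 2 * B * (b - 1) * (t + 1))" by algebra
  also have "\<dots> \<ge> 0" using assms by simp
  finally show "(2 * B * w * (t + 1) + C * w * t) * (b\<^sup>2 * t + b - 1) \<le> (2 * B + C) * (b\<^sup>2 * w) * (t * (t + 1))" by simp
qed (use assms in auto)

subsection \<open>The induction step\<close>

lemma add_Suc_numerals: "Suc (q + 3) = q + 4" "Suc (q + 2) = q + 3"
  by simp_all

section \<open>Two steps of the recursion at multiples of \<open>b\<close>\<close>

lemma offset_count_even_sq:
  assumes "b \<ge> 2" "even q" "u \<ge> 1"
  shows "offset_count b K (q + 4) (b * (b * u)) = offset_count b K (q + 3) (b * u) + offset_count b K (q + 2) u"
proof -
  obtain u' where u: "u = Suc u'" using assms by (cases u) auto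
  have bu: "b * u = Suc (b * u' + (b - 1))" using assms u by simp
  have "offset_count b K (q + 4) (b * (b * u)) = offset_count b K (q + 3) (b * u) + offset_count b K (q + 3) (b * u' + (b - 1))"
    using offset_count_Suc_odd_mult[of b "q + 3" K "b * u' + (b - 1)", unfolded add_Suc_numerals] assms unfolding bu by simp
  also have "offset_count b K (q + 3) (b * u' + (b - 1)) = offset_count b K (q + 2) u"
    using offset_count_Suc_even_add[of "q + 2" "b - 1" b K u', unfolded add_Suc_numerals] assms u by simp
  finally show ?thesis .
qed

lemma offset_count_even_sq_add:
  assumes "b \<ge> 2" "even q"
  shows "offset_count b K (q + 4) (b * (b * u + 1)) = offset_count b K (q + 3) (b * u) + offset_count b K (q + 2) (u + 1)"
  using offset_count_Suc_odd_mult[of b "q + 3" K "b * u", unfolded add_Suc_numerals] offset_count_Suc_even_add[of "q + 2" 1 b K u, unfolded add_Suc_numerals] assms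
  by simp

lemma offset_count_even_pred:
  assumes "b \<ge> 2" "even q"
  shows "offset_count b K (q + 3) (b * u) = offset_count b K (q + 2) (u + 1) + offset_count b K (q + 2) u"
  using offset_count_Suc_even_mult[of b "q + 2" K u, unfolded add_Suc_numerals] assms by simp

text \<open>The first branch is the same for all \<open>r\<close>, the second is largest at residue
  0. As the chord increases, residue 1 is the only nonzero one left to treat.\<close>

lemma offset_count_even_sq_add_le:
  assumes "b \<ge> 2" "even q" "1 \<le> r" "r < b"
  shows "offset_count b K (q + 4) (b * (b * u + r)) \<le> offset_count b K (q + 4) (b * (b * u + 1))"
proof -
  have "offset_count b K (q + 4) (b * (b * u + r)) = offset_count b K (q + 3) (b * u + r) + offset_count b K (q + 3) (b * u + (r - 1))"
    using offset_count_Suc_odd_mult[of b "q + 3" K "b * u + (r - 1)", unfolded add_Suc_numerals] assms by simp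
  moreover have "offset_count b K (q + 4) (b * (b * u + 1)) = offset_count b K (q + 3) (b * u + 1) + offset_count b K (q + 3) (b * u)"
    using offset_count_Suc_odd_mult[of b "q + 3" K "b * u", unfolded add_Suc_numerals] assms by simp
  moreover have "offset_count b K (q + 3) (b * u + r) = offset_count b K (q + 3) (b * u + 1)"
    using offset_count_Suc_even_add[of "q + 2" r b K u, unfolded add_Suc_numerals] offset_count_Suc_even_add[of "q + 2" 1 b K u, unfolded add_Suc_numerals] assms
    by simp
  moreover have "offset_count b K (q + 3) (b * u + (r - 1)) \<le> offset_count b K (q + 3) (b * u)"
    using assms by (intro offset_count_add_le) auto
  ultimately show ?thesis by simp
qed

lemma offset_count_odd_sq_diff:
  assumes "b \<ge> 2" "odd q" "v \<ge> 1"
  shows "offset_count b K (q + 4) (b * (b * v - 1)) = offset_count b K (q + 3) (b * v) + offset_count b K (q + 2) (v - 1)"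
proof -
  obtain v' where v: "v = Suc v'" using assms by (cases v) auto
  have bv: "b * v = Suc (b * v' + (b - 1))" "b * v - 1 = b * v' + (b - 1)" using assms v by simp_all
  have "offset_count b K (q + 4) (b * (b * v - 1)) = offset_count b K (q + 3) (b * v) + offset_count b K (q + 3) (b * v' + (b - 1))"
    using offset_count_Suc_even_mult[of b "q + 3" K "b * v' + (b - 1)", unfolded add_Suc_numerals] assms unfolding bv by simp
  also have "offset_count b K (q + 3) (b * v' + (b - 1)) = offset_count b K (q + 2) (v - 1)"
    using offset_count_Suc_odd_add[of "q + 2" "b - 1" b K v', unfolded add_Suc_numerals] assms v by simp
  finally show ?thesis .
qed

lemma offset_count_odd_sq:
  assumes "b \<ge> 2" "odd q"
  shows "offset_count b K (q + 4) (b * (b * v)) = offset_count b K (q + 3) (b * v) + offset_count b K (q + 2) v"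
  using offset_count_Suc_even_mult[of b "q + 3" K "b * v", unfolded add_Suc_numerals] offset_count_Suc_odd_add[of "q + 2" 1 b K v, unfolded add_Suc_numerals] assms
  by simp

lemma offset_count_odd_pred:
  assumes "b \<ge> 2" "odd q" "v \<ge> 1"
  shows "offset_count b K (q + 3) (b * v) = offset_count b K (q + 2) v + offset_count b K (q + 2) (v - 1)"
  using offset_count_Suc_odd_mult[of b "q + 2" K "v - 1", unfolded add_Suc_numerals] assms by simp

lemma offset_count_odd_sq_add_le:
  assumes "b \<ge> 2" "odd q" "1 \<le> r" "r < b"
  shows "offset_count b K (q + 4) (b * (b * v + r - 1)) \<le> offset_count b K (q + 4) (b * (b * v))"
proof -
  have "offset_count b K (q + 4) (b * (b * v + r - 1)) = offset_count b K (q + 3) (b * v + r) + offset_count b K (q + 3) (b * v + (r - 1))"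
    using offset_count_Suc_even_mult[of b "q + 3" K "b * v + (r - 1)", unfolded add_Suc_numerals] assms by simp
  moreover have "offset_count b K (q + 4) (b * (b * v)) = offset_count b K (q + 3) (b * v + 1) + offset_count b K (q + 3) (b * v)"
    using offset_count_Suc_even_mult[of b "q + 3" K "b * v", unfolded add_Suc_numerals] assms by simp
  moreover have "offset_count b K (q + 3) (b * v + r) = offset_count b K (q + 3) (b * v + 1)"
    using offset_count_Suc_odd_add[of "q + 2" r b K v, unfolded add_Suc_numerals] offset_count_Suc_odd_add[of "q + 2" 1 b K v, unfolded add_Suc_numerals] assms
    by simp
  moreover have "offset_count b K (q + 3) (b * v + (r - 1)) \<le> offset_count b K (q + 3) (b * v)"
    using assms by (intro offset_count_add_le) auto
  ultimately show ?thesis by simp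
qed

text \<open>For the third recursion step: two bounds at level \<open>q + 2\<close> and one at level
  \<open>q + 1\<close>. The two versions differ in which bound is strict.\<close>

lemma double_add_less':
  fixes x y a c h1 h0 z :: real
  assumes "x \<le> h1 + a" "y < h0 + c" "2 * a + c \<le> z"
  shows "2 * x + y < 2 * h1 + h0 + z"
  using assms by linarith

lemma double_add_less:
  fixes x y a c h1 h0 z :: real
  assumes "x < h1 + a" "y \<le> h0 + c" "2 * a + c \<le> z"
  shows "2 * x + y < 2 * h1 + h0 + z"
  using assms by linarith

context
  fixes b K q :: nat
  assumes b2: "b \<ge> 2" and K1: "K \<ge> 1"
    and IH0: "below_chord b K (q + 1)" and IH1: "below_chord b K (q + 2)" and IH2: "below_chord b K (q + 3)"
begin

private abbreviation (input) "rb \<equiv> real b"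
private abbreviation (input) "rK \<equiv> real K"
private abbreviation (input) "C \<equiv> real (fib q)"
private abbreviation (input) "B \<equiv> real (fib (q + 1))"
private abbreviation (input) "A \<equiv> real (fib (q + 2))"
private abbreviation (input) "d \<equiv> gap b (q + 2)"
private abbreviation (input) "h0 \<equiv> chord b K (q + 1) 0"
private abbreviation (input) "h1 \<equiv> chord b K (q + 2) 0"
private abbreviation (input) "h2 \<equiv> chord b K (q + 3) 0"

private lemma A_eq: "A = B + C"
  by simp

private lemma d_ge: "d \<ge> 2"
  using gap_ge_2[OF b2, of "q + 2"] by simp

private lemma chord1: "chord b K (q + 2) x = h1 + rK * (B * x / d)"
  by (simp add: chord_def)

private lemma h2_eq: "h2 = h1 + h0"
  by (simp add: chord_def numeral_eq_Suc algebra_simps)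

private lemma K_le: "x + y \<le> z \<Longrightarrow> rK * x + rK * y \<le> rK * z"
  using mult_left_mono[of "x + y" z rK] by (simp add: distrib_left)

private lemma K_double: "2 * x * y / z + u \<le> v \<Longrightarrow> 2 * (rK * (x * y / z)) + rK * u \<le> rK * v"
  using K_le[of "2 * x * y / z" u v] by (simp add: mult_ac)

private lemma K_less: "x + y < z \<Longrightarrow> rK * x + rK * y < rK * z"
  using mult_strict_left_mono[of "x + y" z rK] K1 by (simp add: distrib_left)

section \<open>Even \<open>q\<close>: the families \<open>y = b u\<close> and
  \<open>y = b u + 1\<close>\<close>

context
  assumes q: "even q"
begin

private abbreviation (input) "t \<equiv> gap b (q + 1)"

private lemma B_pos: "B \<ge> 1"
  using fib_neq_0_nat[of "q + 1"] by simp

private lemma A_le: "8 * A \<le> 13 * B"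
  using fib_ratio_upper[of "q div 2"] q by simp

private lemma d_eq: "d = b * t + b"
  using gap_Suc_odd[of b "q + 1"] b2 q by simp

private lemma gap3: "gap b (q + 3) + b = b * d"
  using gap_Suc_even[of b "q + 2"] b2 q by (simp add: numeral_3_eq_3)

private lemma gap4: "gap b (q + 4) = b * (b * d - b + 1)"
proof -
  have "gap b (q + 3) = b * d - b" using gap3 by simp
  then show ?thesis using gap_Suc_odd[of b "q + 3"] b2 q by (simp add: add_Suc_numerals)
qed

private lemma real_gap3: "real (gap b (q + 3)) = rb * (real d - 1)"
  using gap3[THEN arg_cong, of real] by (simp add: algebra_simps)

private lemma real_gap4: "real (gap b (q + 4)) = rb * (rb * real d - rb + 1)"
proof -
  have "b * 1 \<le> b * d" using d_ge by (intro mult_left_mono) auto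
  then have "real (b * d - b + 1) = rb * real d - rb + 1" by (simp add: of_nat_diff)
  then show ?thesis unfolding gap4 of_nat_mult by simp
qed

private lemma chord0: "chord b K (q + 1) x = h0 + rK * (C * x / t)"
  by (simp add: chord_def)

private lemma chord2: "chord b K (q + 3) (real (b * u)) = h2 + rK * (A * real u / (real d - 1))"
proof -
  have "chord b K (q + 3) (real (b * u)) = h2 + rK * (A * (rb * real u) / (rb * (real d - 1)))"
    unfolding chord_def real_gap3 by (simp add: numeral_3_eq_3)
  also have "A * (rb * real u) / (rb * (real d - 1)) = A * real u / (real d - 1)"
    using b2 by simp
  finally show ?thesis .
qed

private lemma chord3: "chord b K (q + 4) (real (b * y)) = h1 + h2 + rK * ((A + B) * real y / (rb * real d - rb + 1))"
proof -
  have "chord b K (q + 4) (real (b * y)) = h1 + h2 + rK * ((A + B) * (rb * real y) / (rb * (rb * real d - rb + 1)))"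
    unfolding chord_def real_gap4 by (simp add: numeral_eq_Suc algebra_simps)
  also have "(A + B) * (rb * real y) / (rb * (rb * real d - rb + 1)) = (A + B) * real y / (rb * real d - rb + 1)"
    using b2 by simp
  finally show ?thesis .
qed

private lemma bu_le: "u \<le> d - 1 \<Longrightarrow> b * u \<le> gap b (q + 3)"
  using mult_le_mono2[of u "d - 1" b] gap3 by (simp add: diff_mult_distrib2)

private lemma case_1_ternary:
  assumes "b \<ge> 3" "1 \<le> u" "u \<le> d - 1"
  shows "real (offset_count b K (q + 4) (b * (b * u))) < chord b K (q + 4) (real (b * (b * u)))"
proof -
  have e: "real (offset_count b K (q + 4) (b * (b * u))) = real (offset_count b K (q + 3) (b * u)) + real (offset_count b K (q + 2) u)"
    using offset_count_even_sq[OF b2 q assms(2)] by simp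
  have "real (offset_count b K (q + 3) (b * u)) \<le> h2 + rK * (A * real u / (real d - 1))"
    using below_chordD[OF IH2 b2 _ K1 bu_le[OF assms(3)]] chord2 by simp
  moreover have "real (offset_count b K (q + 2) u) < h1 + rK * (B * real u / d)"
    using below_chordD_less[OF IH1, of u] assms d_ge unfolding chord1[of "real u"] by simp
  moreover have sl: "A * real u / (real d - 1) + B * real u / d \<le> (A + B) * (rb * real u) / (rb * real d - rb + 1)"
  proof (rule slopes_even_1)
    \<comment> \<open>For \<open>q = 0\<close> one has \<open>A = B = 1\<close>. Otherwise
      \<open>A \<le> 13/8 B\<close> reduces the claim to \<open>d \<ge> 16/3\<close>, and
      \<open>d \<ge> 9\<close> holds.\<close>
    have "A * real d \<le> B * 2 * (real d - 1)"
    proof (cases "q = 0")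
      case True
      then show ?thesis using d_eq assms by simp
    next
      case False
      then have "t \<ge> 2" using gap_ge_2[OF b2, of "q + 1"] q by (cases q) auto
      then have "3 * t + 3 \<le> d" unfolding d_eq using assms by (intro add_mono mult_right_mono) auto
      then have d: "real d \<ge> 9" using \<open>t \<ge> 2\<close> by linarith
      have "8 * A * real d \<le> 13 * B * real d" using A_le by (rule mult_right_mono) simp
      then have "8 * (A * real d) \<le> 13 * (B * real d)" by (simp only: mult.assoc)
      moreover have "B * 9 \<le> B * real d" using d by (rule mult_left_mono) simp
      moreover have "B * 2 * (real d - 1) = 2 * (B * real d) - 2 * B" by (simp add: right_diff_distrib)
      ultimately show ?thesis using B_pos by linarith
    qed
    also have "\<dots> \<le> B * (rb - 1) * (real d - 1)"
      using assms d_ge by (intro mult_right_mono mult_left_mono) auto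
    finally show "A * real d \<le> B * (rb - 1) * (real d - 1)" .
  qed (use assms d_ge in auto)
  moreover note K_le[OF sl]
  ultimately show ?thesis
    unfolding e chord3 of_nat_mult[of b u] by linarith
qed

private lemma case_1_binary:
  assumes "b = 2" "odd u" "u \<le> d - 1"
  shows "real (offset_count b K (q + 4) (b * (b * u))) < chord b K (q + 4) (real (b * (b * u)))"
proof -
  have u1: "u \<ge> 1" using assms by (cases u) auto
  have e: "real (offset_count b K (q + 4) (b * (b * u))) = real (offset_count b K (q + 3) (b * u)) + real (offset_count b K (q + 2) u)"
    using offset_count_even_sq[OF b2 q u1] by simp
  have "real (offset_count b K (q + 3) (b * u)) \<le> h2 + rK * (A * real u / (real d - 1))"
    using below_chordD[OF IH2 b2 _ K1 bu_le[OF assms(3)]] chord2 by simp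
  moreover have "real (offset_count b K (q + 2) u) \<le> h1 + rK * (B * (real u - 1) / d)"
    using below_chordD_not_dvd[OF IH1 b2 _ K1, of u] assms d_ge chord1[of "real u - 1"] by simp
  moreover have sl: "A * real u / (real d - 1) + B * (real u - 1) / d < (A + B) * (2 * real u) / (2 * real d - 2 + 1)"
    using A_le B_pos A_eq d_ge assms by (intro slopes_even_1_binary) auto
  moreover note K_less[OF sl]
  moreover have "real (b * u) = 2 * real u" "rb = 2" using assms by simp_all
  ultimately show ?thesis
    unfolding e chord3 by simp
qed

text \<open>At \<open>u = 2 w\<close> nothing is gained from rounding, so one branch is expanded
  once more, giving \<open>2 E(2 w)\<close> at level \<open>q + 2\<close> plus \<open>E(w)\<close>
  at level \<open>q + 1\<close>.\<close>

private lemma case_1_binary_dvd: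
  assumes "b = 2" "1 \<le> w" "2 * w \<le> d - 1"
  shows "real (offset_count b K (q + 4) (b * (b * (2 * w)))) < chord b K (q + 4) (real (b * (b * (2 * w))))"
proof -
  have dt: "d = 2 * t + 2" using d_eq assms by simp
  have t: "t \<ge> 1" "w \<le> t" using dt assms by auto
  have q0: "q \<noteq> 0" using t(1) by (cases "q = 0") auto
  have "offset_count b K (q + 2) (b * w + 1) = offset_count b K (q + 1) w"
    using offset_count_Suc_odd_add[of "q + 1" 1 b K w] q b2 by simp
  then have e: "offset_count b K (q + 4) (b * (b * (2 * w))) = 2 * offset_count b K (q + 2) (2 * w) + offset_count b K (q + 1) w"
    using offset_count_even_sq[OF b2 q, of "2 * w" K] offset_count_even_pred[OF b2 q, of K "2 * w"] assms by simp
  have i0: "real (offset_count b K (q + 1) w) \<le> h0 + rK * (C * real w / t)"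
    using below_chordD[OF IH0 b2 _ K1 t(2)] chord0[of w] by simp
  have i1: "real (offset_count b K (q + 2) (2 * w)) < h1 + rK * (B * real (2 * w) / d)"
    using below_chordD_less[OF IH1, of "2 * w"] assms dt unfolding chord1[of "real (2 * w)"] by linarith
  have "q = 2 \<or> q \<ge> 4" using q q0 by presburger
  then consider "q = 2" "w \<ge> 2" | "q = 2" "w = 1" | "q \<ge> 4"
    using assms(2) by linarith
  then show ?thesis
  proof cases
    case 3
    \<comment> \<open>For \<open>q = 2\<close> this would read 9 \<le> 8, hence the separate cases;
      for \<open>q = 4\<close> it is 99 \<le> 100. From \<open>q = 6\<close> on,
      \<open>8 C \<le> 5 B\<close> reduces it to \<open>t \<ge> 15\<close>.\<close>
    have ineq: "3 * C * (real t + 1) \<le> 2 * B * real t"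
    proof (cases "q = 4")
      case True
      have "gap 2 5 = 10" using gap_3[of 2] gap_4[of 2] gap_5[of 2] by simp
      then show ?thesis using True assms by (simp add: numeral_eq_Suc)
    next
      case False
      then have "q \<ge> 6" using 3 q by presburger
      have "gap 2 7 = 42" using gap_3[of 2] gap_4[of 2] gap_5[of 2]
        gap_Suc_odd[of 2 5] gap_Suc_even[of 2 6] by simp
      moreover have "gap b 7 \<le> t" using b2 \<open>q \<ge> 6\<close> by (intro gap_mono) auto
      ultimately have t15: "real t \<ge> 15" using assms by simp
      have "8 * C \<le> 5 * B" using A_le A_eq by simp
      then have "8 * C * (3 * (real t + 1)) \<le> 5 * B * (3 * (real t + 1))" by (rule mult_right_mono) simp
      also have "\<dots> = B * (15 * real t + 15)" by (simp add: algebra_simps)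
      also have "\<dots> \<le> B * (16 * real t)" using t15 by (intro mult_left_mono) auto
      finally have "8 * (3 * C * (real t + 1)) \<le> 8 * (2 * B * real t)" by (simp add: algebra_simps)
      then show ?thesis by linarith
    qed
    have slopes: "2 * B * real w / (real t + 1) + C * real w / real t \<le> (2 * B + C) * (4 * real w) / (4 * real t + 3)"
      using ineq t by (intro slopes_even_1_binary_dvd) auto
    have "B * real (2 * w) / d = B * real w / (real t + 1)"
      unfolding dt by (simp add: divide_simps)
    note i1' = i1[unfolded this]
    have ch: "chord b K (q + 4) (real (b * (b * (2 * w)))) = 2 * h1 + h0 + rK * ((2 * B + C) * (4 * real w) / (4 * real t + 3))"
      unfolding chord3 using assms(1) dt h2_eq A_eq by (simp add: algebra_simps)
    show ?thesis
      unfolding e ch of_nat_add of_nat_mult[of 2 "offset_count b K (q + 2) (2 * w)"] of_nat_numeral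
      by (rule double_add_less[OF i1' i0 K_double[OF slopes]])
  next
    case 2
    have g: "t = 2" "d = 6" using gap_3[of 2] gap_4[of 2] assms 2 by simp_all
    \<comment> \<open>The chord bounds alone give slope terms 11/6 against the available 20/11. As 2
      does not divide 1, the bound at 0 applies at 1.\<close>
    have "real (offset_count b K (q + 1) w) \<le> h0"
      using below_chordD_not_dvd[OF IH0 b2 _ K1, of w] assms 2 g by simp
    moreover have "chord b K (q + 4) (real (b * (b * (2 * w)))) = 2 * h1 + h0 + rK * (40 / 22)"
      unfolding chord3 using assms(1) 2 g h2_eq by (simp add: numeral_eq_Suc)
    moreover have "B * real (2 * w) / d = 4 / 6" using 2 g by (simp add: numeral_eq_Suc)
    note i1[unfolded this]
    ultimately show ?thesis
      using K1 unfolding e of_nat_add of_nat_mult[of 2 "offset_count b K (q + 2) (2 * w)"] of_nat_numeral by linarith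
  next
    case 1
    have g: "t = 2" "d = 6" using gap_3[of 2] gap_4[of 2] assms 1 by simp_all
    have w: "w = 2" using 1 t g by simp
    \<comment> \<open>Next to the constant 21, the chord bounds alone give \<open>35/3 K\<close>
      against the available \<open>128/11 K\<close>. Expanding the level 4 count at 4 once more
      improves the former to \<open>11 K\<close>.\<close>
    have e4: "offset_count b K 4 4 = offset_count b K 3 2 + offset_count b K 2 1"
      using offset_count_even_sq[of b 0 1 K] assms by (simp add: numeral_2_eq_2[symmetric])
    have e2: "offset_count b K 2 1 \<le> 3 + K"
      using offset_count_add_le[of b 2 1 K 0] offset_count_0[of b 2 K] assms by (simp add: numeral_eq_Suc)
    have "h0 = 5 + 2 * rK" "C * real w / real t = 1"
      using 1 w g by (simp_all add: chord_def numeral_eq_Suc)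
    note i0[unfolded this]
    then have "real (offset_count b K 3 2) \<le> 5 + 3 * K"
      using 1 w by simp
    then have "real (offset_count b K (q + 4) (b * (b * (2 * w)))) \<le> 21 + 11 * K"
      using e e4 e2 1 w by simp
    moreover have "chord b K (q + 4) (real (b * (b * (2 * w)))) = 21 + 8 * K + rK * (80 / 22)"
      unfolding chord3 using assms(1) 1 w g by (simp add: numeral_eq_Suc chord_def)
    ultimately show ?thesis
      using K1 by simp
  qed
qed

private lemma case_2:
  assumes "u + 1 < d" "\<not> b dvd u + 1"
  shows "real (offset_count b K (q + 4) (b * (b * u + 1))) < chord b K (q + 4) (real (b * (b * u + 1)))"
proof -
  have e: "real (offset_count b K (q + 4) (b * (b * u + 1))) = real (offset_count b K (q + 3) (b * u)) + real (offset_count b K (q + 2) (u + 1))"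
    using offset_count_even_sq_add[OF b2 q] by simp
  have "real (offset_count b K (q + 3) (b * u)) \<le> h2 + rK * (A * real u / (real d - 1))"
    using below_chordD[OF IH2 b2 _ K1 bu_le, of u] assms chord2 by simp
  moreover have "real (offset_count b K (q + 2) (u + 1)) \<le> h1 + rK * (B * real u / d)"
    using below_chordD_not_dvd[OF IH1 b2 _ K1, of "u + 1"] assms chord1[of "real u"] by simp
  moreover have sl: "A * real u / (real d - 1) + B * real u / d < (A + B) * (rb * real u + 1) / (rb * real d - rb + 1)"
    using A_eq B_pos d_ge assms b2 by (intro slopes_even_2) auto
  moreover have eq: "real (b * u + 1) = rb * real u + 1" by simp
  moreover note K_less[OF sl]
  ultimately show ?thesis
    unfolding e chord3 eq by linarith
qed

private lemma case_2_binary: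
  assumes "b = 2" "u + 1 < d"
  shows "real (offset_count b K (q + 4) (b * (b * u + 1))) < chord b K (q + 4) (real (b * (b * u + 1)))"
proof -
  have e: "real (offset_count b K (q + 4) (b * (b * u + 1))) = real (offset_count b K (q + 3) (b * u)) + real (offset_count b K (q + 2) (u + 1))"
    using offset_count_even_sq_add[OF b2 q] by simp
  have "real (offset_count b K (q + 3) (b * u)) \<le> h2 + rK * (A * real u / (real d - 1))"
    using below_chordD[OF IH2 b2 _ K1 bu_le, of u] assms chord2 by simp
  moreover have "real (offset_count b K (q + 2) (u + 1)) < h1 + rK * (B * (real u + 1) / d)"
    using below_chordD_less[OF IH1, of "u + 1"] assms chord1[of "real u + 1"] by (simp add: add.commute)
  moreover have sl: "A * real u / (real d - 1) + B * (real u + 1) / d \<le> (A + B) * (2 * real u + 1) / (2 * real d - 2 + 1)"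
    using A_eq B_pos d_ge assms b2 by (intro slopes_even_2_binary) auto
  moreover have eq: "real (b * u + 1) = 2 * real u + 1" "rb = 2" using assms by simp_all
  moreover note K_le[OF sl]
  ultimately show ?thesis
    unfolding e chord3 eq by linarith
qed

private lemma case_2_dvd:
  assumes "b \<ge> 3" "1 \<le> w" "b * w < d"
  shows "real (offset_count b K (q + 4) (b * (b * (b * w - 1) + 1))) < chord b K (q + 4) (real (b * (b * (b * w - 1) + 1)))"
proof -
  have "b * w < b * (t + 1)" using assms d_eq by simp
  then have "w < t + 1" using mult_less_cancel1 by blast
  then have t: "t \<ge> 1" "w \<le> t" using assms by auto
  have q0: "q \<noteq> 0" using t(1) by (cases "q = 0") auto
  obtain w' where w': "w = Suc w'" using assms by (cases w) auto
  have bw: "b * w - 1 = b * w' + (b - 1)" "b * w - 1 + 1 = b * w" using w' b2 by simp_all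
  have e1: "offset_count b K (q + 2) (b * w - 1) = offset_count b K (q + 1) (w - 1)"
    unfolding bw(1) using offset_count_Suc_odd_add[of "q + 1" "b - 1" b K w'] q b2 w' by simp
  have e: "offset_count b K (q + 4) (b * (b * (b * w - 1) + 1)) = 2 * offset_count b K (q + 2) (b * w) + offset_count b K (q + 1) (w - 1)"
    using offset_count_even_sq_add[OF b2 q, of K "b * w - 1"] offset_count_even_pred[OF b2 q, of K "b * w - 1"] e1 bw(2) by simp
  have i0: "real (offset_count b K (q + 1) (w - 1)) \<le> h0 + rK * (C * (real w - 1) / t)"
    using below_chordD[OF IH0 b2 _ K1, of "w - 1"] t assms chord0[of "real w - 1"] by (simp add: of_nat_diff)
  have i1: "real (offset_count b K (q + 2) (b * w)) < h1 + rK * (B * real (b * w) / d)"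
    using below_chordD_less[OF IH1, of "b * w"] assms b2 unfolding chord1[of "real (b * w)"] by simp
  \<comment> \<open>For \<open>b = 3\<close>, \<open>q = 2\<close> this is 48 \<le> 49; for larger
    \<open>q\<close>, \<open>3 B \<le> 5 C\<close> suffices. For \<open>b \<ge> 4\<close> it follows
    from \<open>B \<le> 2 C\<close> and \<open>(b - 4)(b - 1) \<ge> 0\<close>.\<close>
  have ineq: "2 * B * (rb - 1) * t \<le> C * (rb\<^sup>2 - rb + 1) * (real t + 1)"
  proof (cases "b = 3")
    case True
    show ?thesis
    proof (cases "q = 2")
      case True
      then show ?thesis using gap_3[of 3] \<open>b = 3\<close> by (simp add: numeral_eq_Suc)
    next
      case False
      then have "\<exists>j. q = 2 * Suc (Suc j)" using q q0 by presburger
      then have "3 * fib (q + 1) \<le> 5 * fib q" using fib_ratio_lower' by auto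
      then have "3 * B \<le> 5 * C" by linarith
      then have "3 * B * real t \<le> 5 * C * real t" by (rule mult_right_mono) simp
      moreover have "C * real t \<ge> 0" by simp
      moreover have "2 * B * (rb - 1) * t = 4 * (B * real t)" "C * (rb\<^sup>2 - rb + 1) * (real t + 1) = 7 * (C * real t) + 7 * C"
        using True by (simp_all add: algebra_simps)
      ultimately show ?thesis by linarith
    qed
  next
    case False
    then have b4: "rb \<ge> 4" using assms by simp
    have "\<exists>j. q = 2 * Suc j" using q q0 by presburger
    then have "fib (q + 1) \<le> 2 * fib q" using fib_ratio_lower by auto
    then have BC: "B \<le> 2 * C" by linarith
    have "4 * (rb - 1) \<le> rb\<^sup>2 - rb + 1"
      using mult_nonneg_nonneg[of "rb - 4" "rb - 1"] b4 by (simp add: power2_eq_square algebra_simps)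
    then have "(2 * B) * (rb - 1) * t \<le> (2 * (2 * C)) * (rb - 1) * t" using BC b4
      by (intro mult_right_mono) auto
    also have "\<dots> = C * (4 * (rb - 1)) * t" by simp
    also have "\<dots> \<le> C * (rb\<^sup>2 - rb + 1) * (real t + 1)"
      using \<open>4 * (rb - 1) \<le> _\<close> b4 by (intro mult_mono mult_left_mono) auto
    finally show ?thesis .
  qed
  have slopes: "2 * B * real w / (real t + 1) + C * (real w - 1) / real t
      \<le> (2 * B + C) * (rb\<^sup>2 * real w - rb + 1) / (rb\<^sup>2 * (real t + 1) - rb + 1)"
    using ineq t b2 by (intro slopes_even_2_dvd) auto
  have "B * real (b * w) / d = B * real w / (real t + 1)"
  proof -
    have "real d = rb * (real t + 1)" unfolding d_eq by (simp add: algebra_simps)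
    then have "B * real (b * w) / d = rb * (B * real w) / (rb * (real t + 1))" by simp
    then show ?thesis using b2 by simp
  qed
  note i1' = i1[unfolded this]
  have ch: "chord b K (q + 4) (real (b * (b * (b * w - 1) + 1)))
      = 2 * h1 + h0 + rK * ((2 * B + C) * (rb\<^sup>2 * real w - rb + 1) / (rb\<^sup>2 * (real t + 1) - rb + 1))"
  proof -
    have "real (b * w - 1) = rb * real w - 1" using b2 assms by (simp add: of_nat_diff)
    then have "real (b * (b * w - 1) + 1) = rb * (rb * real w - 1) + 1"
      unfolding of_nat_add of_nat_mult[of b "b * w - 1"] by simp
    then have "real (b * (b * w - 1) + 1) = rb\<^sup>2 * real w - rb + 1"
      by (simp only: power2_eq_square) (simp add: algebra_simps del: of_nat_mult of_nat_add of_nat_diff)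
    moreover have "rb * real d - rb + 1 = rb\<^sup>2 * (real t + 1) - rb + 1"
      unfolding d_eq by (simp add: power2_eq_square algebra_simps)
    moreover have "A + B = 2 * B + C" using A_eq by simp
    ultimately show ?thesis unfolding chord3 h2_eq by simp
  qed
  show ?thesis
    unfolding e ch of_nat_add of_nat_mult[of 2 "offset_count b K (q + 2) (b * w)"] of_nat_numeral
    by (rule double_add_less[OF i1' i0 K_double[OF slopes]])
qed

lemma below_chord_step_even: "below_chord b K (q + 4)"
proof (rule below_chordI[OF b2 _ K1])
  fix y assume y: "0 < y" "b * y < gap b (q + 4)"
  define u r where "u = y div b" and "r = y mod b"
  have yu: "y = b * u + r" and r: "r < b" using b2 by (simp_all add: u_def r_def)
  have "b * y < b * (b * d - b + 1)" using y gap4 by simp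
  then have "y < b * d - b + 1" using mult_less_cancel1 by blast
  moreover have "b * 1 \<le> b * d" using d_ge by (intro mult_left_mono) auto
  ultimately have yd: "y + b \<le> b * d" by linarith
  show "real (offset_count b K (q + 4) (b * y)) < chord b K (q + 4) (real (b * y))"
  proof (cases "r = 0")
    case True
    have "b * (u + 1) \<le> b * d" using yd yu True by simp
    then have "u + 1 \<le> d" using b2 by (subst (asm) mult_le_cancel1) auto
    then have ud: "u \<le> d - 1" by simp
    have u1: "u \<ge> 1" using y yu True by (cases u) auto
    show ?thesis
    proof (cases "b = 2")
      case False
      then show ?thesis using case_1_ternary[OF _ u1 ud] b2 yu True by simp
    next
      case b: True
      show ?thesis
      proof (cases "odd u")
        case False
        then obtain w where "u = 2 * w" by blast
        then show ?thesis using case_1_binary_dvd[OF b, of w] u1 ud yu True by simp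
      qed (use case_1_binary[OF b _ ud] yu True in simp)
    qed
  next
    case False
    have "b * (u + 1) < b * d" using yd yu False by simp
    then have ud: "u + 1 < d" using mult_less_cancel1 by blast
    have *: "real (offset_count b K (q + 4) (b * (b * u + 1))) < chord b K (q + 4) (real (b * (b * u + 1)))"
    proof (cases "b dvd u + 1")
      case True
      then obtain w where w: "u + 1 = b * w" by blast
      then have u: "u = b * w - 1" "w \<ge> 1" by (simp, cases w, auto)
      then show ?thesis
        using case_2_dvd[of w] case_2_binary[of u] b2 ud w by (cases "b = 2") auto
    qed (use case_2 ud in simp)
    have "real (offset_count b K (q + 4) (b * y)) \<le> real (offset_count b K (q + 4) (b * (b * u + 1)))"
      using offset_count_even_sq_add_le[OF b2 q, of r K u] False r yu by simp
    also note *
    also have "chord b K (q + 4) (real (b * (b * u + 1))) \<le> chord b K (q + 4) (real (b * y))"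
      unfolding yu using False by (intro chord_mono of_nat_mono mult_le_mono2) simp
    finally show ?thesis .
  qed
qed simp

end

section \<open>Odd \<open>q\<close>: the families \<open>y = b v - 1\<close> and
  \<open>y = b v\<close>\<close>

context
  assumes q: "odd q"
begin

text \<open>One less than the gap, so that \<open>d = b t'\<close>.\<close>

private abbreviation (input) "t' \<equiv> gap b (q + 1) - 1"

private lemma C_pos: "C \<ge> 1"
  using fib_neq_0_nat[of q] q by (cases q) auto

private lemma C_le_B: "C \<le> B"
  using q by (cases q) auto

private lemma B_le: "3 * B \<le> 5 * C"
proof -
  have "\<exists>j. q = Suc (2 * j)" using q by presburger
  then obtain j where j: "q = Suc (2 * j)" by blast
  then have "3 * fib (q + 1) \<le> 5 * fib q" using fib_ratio_upper[of j] by simp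
  then show ?thesis by linarith
qed

private lemma q1: "q \<ge> 1"
  using q by (cases q) auto

private lemma t_ge: "t' \<ge> 1" "gap b (q + 1) = t' + 1"
  using gap_ge_2[OF b2, of "q + 1"] q1 by simp_all

private lemma d_eq': "d = b * t'"
proof -
  have "d + b = b * gap b (q + 1)"
    using gap_Suc_even[of b "q + 1"] b2 q by simp
  also have "\<dots> = b * t' + b" using t_ge(2) by (metis add_mult_distrib2 mult_1_right)
  finally show ?thesis by simp
qed

private lemma gap3': "gap b (q + 3) = b * d + b"
  using gap_Suc_odd[of b "q + 2"] b2 q by (simp add: numeral_3_eq_3)

private lemma gap4': "gap b (q + 4) + b = b * (b * d + b)"
  using gap_Suc_even[of b "q + 3"] b2 q gap3' by (simp add: add_Suc_numerals)

private lemma real_t: "real (gap b (q + 1)) = real t' + 1"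
  using t_ge by simp

private lemma real_d: "real d = rb * real t'"
  unfolding d_eq' by simp

private lemma real_gap4': "real (gap b (q + 4)) = rb * (rb * real d + rb - 1)"
proof -
  have "real (gap b (q + 4)) + rb = rb * (rb * real d + rb)"
    using gap4'[THEN arg_cong, of real] by (simp only: of_nat_add of_nat_mult)
  then show ?thesis by (simp add: right_diff_distrib)
qed

private lemma chord0': "chord b K (q + 1) x = h0 + rK * (C * x / (real t' + 1))"
  unfolding chord_def real_t by simp

private lemma chord2': "chord b K (q + 3) (real (b * u)) = h2 + rK * (A * real u / (real d + 1))"
proof -
  have "real (gap b (q + 3)) = rb * (real d + 1)" unfolding gap3' by (simp add: distrib_left)
  then have "chord b K (q + 3) (real (b * u)) = h2 + rK * (A * (rb * real u) / (rb * (real d + 1)))"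
    unfolding chord_def by (simp add: numeral_3_eq_3)
  also have "A * (rb * real u) / (rb * (real d + 1)) = A * real u / (real d + 1)"
    using b2 by simp
  finally show ?thesis .
qed

private lemma chord3': "chord b K (q + 4) (real (b * y)) = h1 + h2 + rK * ((A + B) * real y / (rb * real d + rb - 1))"
proof -
  have "chord b K (q + 4) (real (b * y)) = h1 + h2 + rK * ((A + B) * (rb * real y) / (rb * (rb * real d + rb - 1)))"
    unfolding chord_def real_gap4' by (simp add: numeral_eq_Suc algebra_simps)
  also have "(A + B) * (rb * real y) / (rb * (rb * real d + rb - 1)) = (A + B) * real y / (rb * real d + rb - 1)"
    using b2 by simp
  finally show ?thesis .
qed

text \<open>Every \<open>v \<le> d\<close> gives an interior point at level \<open>q + 3\<close>;
  this supplies the strictness in the cases that stop after two recursion steps.\<close>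

private lemma count_q3_less:
  assumes "1 \<le> v" "v \<le> d"
  shows "real (offset_count b K (q + 3) (b * v)) < h2 + rK * (A * real v / (real d + 1))"
proof -
  have "b * v \<le> b * d" using assms by simp
  then have "b * v < gap b (q + 3)" using gap3' b2 by linarith
  then show ?thesis
    using below_chordD_less[OF IH2, of "b * v"] assms b2 unfolding chord2' by simp
qed

private lemma real_pred: "1 \<le> v \<Longrightarrow> real (b * v - 1) = rb * real v - 1"
  using b2 by (simp add: of_nat_diff)

private lemma slopes_1_ternary:
  assumes "b \<ge> 3" "v \<le> d"
  shows "A * real v / (real d + 1) + B * (real v - 1) / d \<le> (A + B) * (rb * real v - 1) / (rb * real d + rb - 1)"
proof (rule slopes_odd_1)
  have "A * real d \<le> (B * 2) * (real d + 1)"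
    using A_eq C_le_B by (intro mult_mono) auto
  also have "\<dots> \<le> B * (rb - 1) * (real d + 1)"
    using assms by (intro mult_right_mono mult_left_mono) auto
  finally show "A * real d \<le> B * (rb - 1) * (real d + 1)" .
qed (use assms d_ge in auto)

private lemma case_1_ternary':
  assumes "b \<ge> 3" "1 \<le> v" "v \<le> d"
  shows "real (offset_count b K (q + 4) (b * (b * v - 1))) < chord b K (q + 4) (real (b * (b * v - 1)))"
proof -
  have e: "real (offset_count b K (q + 4) (b * (b * v - 1))) = real (offset_count b K (q + 3) (b * v)) + real (offset_count b K (q + 2) (v - 1))"
    using offset_count_odd_sq_diff[OF b2 q assms(2)] by simp
  have "real (offset_count b K (q + 2) (v - 1)) \<le> h1 + rK * (B * (real v - 1) / d)"
    using below_chordD[OF IH1 b2 _ K1, of "v - 1"] assms chord1[of "real v - 1"] by (simp add: of_nat_diff)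
  moreover note count_q3_less[OF assms(2,3)] K_le[OF slopes_1_ternary[OF assms(1,3)]]
  ultimately show ?thesis
    unfolding e chord3' real_pred[OF assms(2)] by linarith
qed

private lemma case_1_binary':
  assumes "b = 2" "1 \<le> v" "even v" "v \<le> d"
  shows "real (offset_count b K (q + 4) (b * (b * v - 1))) < chord b K (q + 4) (real (b * (b * v - 1)))"
proof -
  have v2: "v \<ge> 2" using assms(2,3) by presburger
  have e: "real (offset_count b K (q + 4) (b * (b * v - 1))) = real (offset_count b K (q + 3) (b * v)) + real (offset_count b K (q + 2) (v - 1))"
    using offset_count_odd_sq_diff[OF b2 q assms(2)] by simp
  have eq: "real (v - 1) - 1 = real v - 2" "rb = 2" using v2 assms by simp_all
  have "\<not> b dvd v - 1" using assms v2 by simp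
  then have "real (offset_count b K (q + 2) (v - 1)) \<le> h1 + rK * (B * (real v - 2) / d)"
    using below_chordD_not_dvd[OF IH1 b2 _ K1, of "v - 1"] assms unfolding eq chord1[of "real v - 2"] by simp
  moreover have "A * real v / (real d + 1) + B * (real v - 2) / d \<le> (A + B) * (2 * real v - 1) / (2 * real d + 2 - 1)"
    using A_eq C_le_B d_ge v2 assms(4) by (intro slopes_odd_1_binary) auto
  note K_le[OF this]
  moreover note count_q3_less[OF assms(2,4)]
  ultimately show ?thesis
    unfolding e chord3' real_pred[OF assms(2)] eq by linarith
qed

private lemma case_1_binary_dvd':
  assumes "b = 2" "2 * w + 1 \<le> d"
  shows "real (offset_count b K (q + 4) (b * (b * (2 * w + 1) - 1))) < chord b K (q + 4) (real (b * (b * (2 * w + 1) - 1)))"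
proof -
  have w: "w < t'" using d_eq' assms by simp
  have rb: "rb = 2" using assms by simp
  have "offset_count b K (q + 2) (b * w + 1) = offset_count b K (q + 1) (w + 1)"
    using offset_count_Suc_even_add[of "q + 1" 1 b K w] q b2 by simp
  then have e: "offset_count b K (q + 4) (b * (b * (2 * w + 1) - 1)) = 2 * offset_count b K (q + 2) (2 * w) + offset_count b K (q + 1) (w + 1)"
    using offset_count_odd_sq_diff[OF b2 q, of "2 * w + 1" K] offset_count_odd_pred[OF b2 q, of "2 * w + 1" K] assms by simp
  have i0: "real (offset_count b K (q + 1) (w + 1)) < h0 + rK * (C * (real w + 1) / (real t' + 1))"
    using below_chordD_less[OF IH0, of "w + 1"] w chord0'[of "real w + 1"] by (simp add: add.commute)
  have i1: "real (offset_count b K (q + 2) (2 * w)) \<le> h1 + rK * (B * real (2 * w) / d)"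
    using below_chordD[OF IH1 b2 _ K1, of "2 * w"] assms unfolding chord1[of "real (2 * w)"] by simp
  \<comment> \<open>For \<open>q = 1\<close> this is 3 \<le> 4; from \<open>q = 3\<close> on,
    already \<open>3 C \<le> 2 B\<close>.\<close>
  have "3 * C * real t' \<le> 2 * B * (real t' + 1)"
  proof (cases "q = 1")
    case True
    then show ?thesis using gap_2[of 2] assms by (simp add: numeral_2_eq_2)
  next
    case False
    then have "\<exists>j. q = Suc (2 * Suc j)" using q by presburger
    then obtain j where "q = Suc (2 * Suc j)" by blast
    then have "3 * fib q \<le> 2 * fib (q + 1)" using fib_ratio_lower[of j] by simp
    then have "3 * C \<le> 2 * B" by linarith
    then show ?thesis by (rule mult_mono) auto
  qed
  then have slopes: "2 * B * real w / real t' + C * (real w + 1) / (real t' + 1) \<le> (2 * B + C) * (4 * real w + 1) / (4 * real t' + 1)"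
    using w by (intro slopes_odd_1_binary_dvd) auto
  have "B * real (2 * w) / d = B * real w / real t'"
    unfolding real_d rb by simp
  note i1' = i1[unfolded this]
  have ch: "chord b K (q + 4) (real (b * (b * (2 * w + 1) - 1)))
     = 2 * h1 + h0 + rK * ((2 * B + C) * (4 * real w + 1) / (4 * real t' + 1))"
  proof -
    have "real (b * (2 * w + 1) - 1) = 4 * real w + 1" using assms by simp
    moreover have "rb * real d + rb - 1 = 4 * real t' + 1" unfolding real_d rb by simp
    moreover have "A + B = 2 * B + C" using A_eq by simp
    ultimately show ?thesis unfolding chord3' h2_eq by simp
  qed
  show ?thesis
    unfolding e ch of_nat_add of_nat_mult[of 2 "offset_count b K (q + 2) (2 * w)"] of_nat_numeral
    by (rule double_add_less'[OF i1' i0 K_double[OF slopes]])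
qed

private lemma case_2_binary':
  assumes "b = 2" "1 \<le> v" "v \<le> d"
  shows "real (offset_count b K (q + 4) (b * (b * v))) < chord b K (q + 4) (real (b * (b * v)))"
proof -
  have e: "real (offset_count b K (q + 4) (b * (b * v))) = real (offset_count b K (q + 3) (b * v)) + real (offset_count b K (q + 2) v)"
    using offset_count_odd_sq[OF b2 q] by simp
  have eq: "real (b * v) = 2 * real v" "rb = 2" using assms by simp_all
  have "real (offset_count b K (q + 2) v) \<le> h1 + rK * (B * real v / d)"
    using below_chordD[OF IH1 b2 _ K1, of v] assms unfolding chord1[of "real v"] by simp
  moreover have "A * real v / (real d + 1) + B * real v / d \<le> (A + B) * (2 * real v) / (2 * real d + 2 - 1)"
  proof (rule slopes_odd_2_binary)
    \<comment> \<open>With \<open>A = B + C\<close> the claim reduces to \<open>B \<le> C d\<close>,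
      where \<open>d \<ge> 2\<close> and \<open>B \<le> 5/3 C\<close>.\<close>
    have "C * 2 \<le> C * real d" using d_ge by (intro mult_left_mono) auto
    then have "B \<le> C * real d" using B_le C_pos by linarith
    then show "B * (real d + 1) \<le> A * real d" unfolding A_eq by (simp add: distrib_left distrib_right)
  qed (use d_ge in auto)
  note K_le[OF this]
  moreover note count_q3_less[OF assms(2,3)]
  ultimately show ?thesis
    unfolding e chord3' eq by linarith
qed

text \<open>The bound at \<open>v - 1\<close> holds at \<open>v\<close>, which places the total
  below the chord at \<open>b v - 1\<close>, a point of the other family just to the left.\<close>

private lemma case_2_ternary:
  assumes "b \<ge> 3" "1 \<le> v" "v \<le> d" "\<not> b dvd v"
  shows "real (offset_count b K (q + 4) (b * (b * v))) < chord b K (q + 4) (real (b * (b * v)))"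
proof -
  have e: "real (offset_count b K (q + 4) (b * (b * v))) = real (offset_count b K (q + 3) (b * v)) + real (offset_count b K (q + 2) v)"
    using offset_count_odd_sq[OF b2 q] by simp
  have "real (offset_count b K (q + 2) v) \<le> h1 + rK * (B * (real v - 1) / d)"
    using below_chordD_not_dvd[OF IH1 b2 _ K1, of v] assms unfolding chord1[of "real v - 1"] by simp
  moreover note count_q3_less[OF assms(2,3)] K_le[OF slopes_1_ternary[OF assms(1,3)]]
  moreover have "chord b K (q + 4) (real (b * (b * v - 1))) \<le> chord b K (q + 4) (real (b * (b * v)))"
    by (intro chord_mono of_nat_mono mult_le_mono2) simp
  then have "h1 + h2 + rK * ((A + B) * (rb * real v - 1) / (rb * real d + rb - 1)) \<le> chord b K (q + 4) (real (b * (b * v)))"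
    unfolding chord3'[of "b * v - 1"] real_pred[OF assms(2)] .
  ultimately show ?thesis
    unfolding e by linarith
qed

text \<open>The neighbour \<open>b w - 1\<close> has residue \<open>b - 1\<close> and drops to
  \<open>w\<close> at level \<open>q + 1\<close>.\<close>

private lemma case_2_dvd':
  assumes "b \<ge> 3" "1 \<le> w" "b * w \<le> d"
  shows "real (offset_count b K (q + 4) (b * (b * (b * w)))) < chord b K (q + 4) (real (b * (b * (b * w))))"
proof -
  have w: "w \<le> t'" using assms b2 unfolding d_eq' by (subst (asm) mult_le_cancel1) auto
  obtain w' where w': "w = Suc w'" using assms by (cases w) auto
  have bw: "b * w - 1 = b * w' + (b - 1)" "b * w \<ge> 1" using w' b2 by simp_all
  have e1: "offset_count b K (q + 2) (b * w - 1) = offset_count b K (q + 1) w"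
    unfolding bw(1) using offset_count_Suc_even_add[of "q + 1" "b - 1" b K w'] q b2 w' by simp
  have e: "offset_count b K (q + 4) (b * (b * (b * w))) = 2 * offset_count b K (q + 2) (b * w) + offset_count b K (q + 1) w"
    using offset_count_odd_sq[OF b2 q, of K "b * w"] offset_count_odd_pred[OF b2 q bw(2), of K] e1 by simp
  have i0: "real (offset_count b K (q + 1) w) < h0 + rK * (C * real w / (real t' + 1))"
    using below_chordD_less[OF IH0, of w] w assms t_ge unfolding chord0'[of "real w"] by simp
  have i1: "real (offset_count b K (q + 2) (b * w)) \<le> h1 + rK * (B * real (b * w) / d)"
    using below_chordD[OF IH1 b2 _ K1, of "b * w"] assms unfolding chord1[of "real (b * w)"] by simp
  have b3: "rb \<ge> 3" using assms by simp
  \<comment> \<open>For \<open>q = 1\<close> the common factor \<open>t' = b - 1\<close> cancels and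
    \<open>b (b - 3) \<ge> 0\<close> suffices.\<close>
  have "2 * B * (rb - 1) * (real t' + 1) \<le> C * (rb\<^sup>2 - rb + 1) * real t'"
  proof (cases "q = 1")
    case True
    have "0 \<le> (rb - 3) * rb" using b3 by simp
    then have "2 * rb \<le> rb\<^sup>2 - rb + 1" by (simp add: power2_eq_square algebra_simps)
    then have "(rb - 1) * (2 * rb) \<le> (rb - 1) * (rb\<^sup>2 - rb + 1)" using b3 by (intro mult_left_mono) auto
    moreover have eq: "real t' = rb - 1" "B = 1" "C = 1"
      using True gap_2[OF b2] b2 by (simp_all add: numeral_2_eq_2)
    ultimately show ?thesis unfolding eq by (simp add: algebra_simps)
  next
    case False
    have g3: "gap b 3 + b = b * b" by (rule gap_3[OF b2])
    have "3 * b \<le> b * b" using assms by simp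
    then have "gap b 3 \<ge> 6" using g3 assms by linarith
    then have "3 * 6 \<le> b * gap b 3" using assms by (intro mult_le_mono) auto
    then have "gap b 4 \<ge> 21" using gap_4[OF b2] assms by linarith
    moreover have "q + 1 \<ge> 4" using q False by presburger
    then have "gap b 4 \<le> gap b (q + 1)" using b2 by (intro gap_mono) auto
    ultimately have t20: "real t' \<ge> 20" by simp
    \<comment> \<open>After \<open>3 B \<le> 5 C\<close> the need is
      \<open>10 (b - 1) \<le> (3 b^2 - 13 b + 13) t'\<close>. At \<open>b = 3\<close> this says
      \<open>t' \<ge> 20\<close>, just met since \<open>gap 3 4 = 21\<close>; with
      \<open>t' = 20\<close> it becomes \<open>30 (b - 3)(2 b - 3) \<ge> 0\<close>.\<close>
    have "0 \<le> (rb - 3) * (2 * rb - 3)" using b3 by simp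
    then have "10 * (rb - 1) \<le> (3 * rb\<^sup>2 - 13 * rb + 13) * 20"
      by (simp add: power2_eq_square algebra_simps)
    also have "\<dots> \<le> (3 * rb\<^sup>2 - 13 * rb + 13) * real t'"
    proof (rule mult_left_mono[OF t20])
      have "0 \<le> (rb - 3) * (3 * rb - 4)" using b3 by simp
      then show "0 \<le> 3 * rb\<^sup>2 - 13 * rb + 13" by (simp add: power2_eq_square algebra_simps)
    qed
    finally have *: "10 * (rb - 1) * (real t' + 1) \<le> 3 * (rb\<^sup>2 - rb + 1) * real t'"
      by (simp add: algebra_simps)
    have "3 * B * (2 * (rb - 1) * (real t' + 1)) \<le> 5 * C * (2 * (rb - 1) * (real t' + 1))"
      using B_le b3 by (intro mult_right_mono) auto
    also have "\<dots> = C * (10 * (rb - 1) * (real t' + 1))" by simp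
    also have "\<dots> \<le> C * (3 * (rb\<^sup>2 - rb + 1) * real t')"
      using * by (intro mult_left_mono) auto
    finally have "3 * (2 * B * (rb - 1) * (real t' + 1)) \<le> 3 * (C * (rb\<^sup>2 - rb + 1) * real t')"
      by (simp add: algebra_simps)
    then show ?thesis by linarith
  qed
  then have slopes: "2 * B * real w / real t' + C * real w / (real t' + 1)
      \<le> (2 * B + C) * (rb\<^sup>2 * real w) / (rb\<^sup>2 * real t' + rb - 1)"
    using w t_ge b3 by (intro slopes_odd_2_dvd) auto
  have "B * real (b * w) / d = B * real w / real t'"
  proof -
    have "B * real (b * w) / d = rb * (B * real w) / (rb * real t')" unfolding real_d by simp
    then show ?thesis using b2 by simp
  qed
  note i1' = i1[unfolded this]
  have ch: "chord b K (q + 4) (real (b * (b * (b * w))))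
     = 2 * h1 + h0 + rK * ((2 * B + C) * (rb\<^sup>2 * real w) / (rb\<^sup>2 * real t' + rb - 1))"
  proof -
    have "real (b * (b * w)) = rb\<^sup>2 * real w" by (simp add: power2_eq_square)
    moreover have "rb * real d + rb - 1 = rb\<^sup>2 * real t' + rb - 1" unfolding real_d by (simp add: power2_eq_square)
    moreover have "A + B = 2 * B + C" using A_eq by simp
    ultimately show ?thesis unfolding chord3' h2_eq by simp
  qed
  show ?thesis
    unfolding e ch of_nat_add of_nat_mult[of 2 "offset_count b K (q + 2) (b * w)"] of_nat_numeral
    by (rule double_add_less'[OF i1' i0 K_double[OF slopes]])
qed

lemma below_chord_step_odd: "below_chord b K (q + 4)"
proof (rule below_chordI[OF b2 _ K1])
  fix y assume y: "0 < y" "b * y < gap b (q + 4)"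
  \<comment> \<open>Division is applied to \<open>y + 1\<close>, since for odd \<open>q\<close> the
    exceptional residue of \<open>y\<close> is \<open>b - 1\<close> instead of 0.\<close>
  define v r where "v = (y + 1) div b" and "r = (y + 1) mod b"
  have yv: "y + 1 = b * v + r" and r: "r < b" using b2 by (simp_all add: v_def r_def)
  have "b * (y + 1) < b * (b * d + b)" using y gap4' by (simp add: distrib_left)
  then have "y + 1 < b * d + b" using mult_less_cancel1 by blast
  then have "b * v < b * (d + 1)" using yv by simp
  then have "v < d + 1" using mult_less_cancel1 by blast
  then have vd: "v \<le> d" by simp
  show "real (offset_count b K (q + 4) (b * y)) < chord b K (q + 4) (real (b * y))"
  proof (cases "r = 0")
    case True
    have v1: "v \<ge> 1" using yv True by (cases v) auto
    have yv': "y = b * v - 1" using yv True by simp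
    show ?thesis
    proof (cases "b = 2")
      case False
      then show ?thesis using case_1_ternary'[OF _ v1 vd] b2 yv' by simp
    next
      case b: True
      show ?thesis
      proof (cases "even v")
        case True
        then show ?thesis using case_1_binary'[OF b v1 _ vd] yv' by simp
      next
        case False
        then obtain w where w: "v = 2 * w + 1" by (auto elim: oddE)
        show ?thesis using case_1_binary_dvd'[OF b, of w] vd unfolding yv' w by simp
      qed
    qed
  next
    case False
    have yv': "y = b * v + r - 1" using yv by simp
    have le: "real (offset_count b K (q + 4) (b * y)) \<le> real (offset_count b K (q + 4) (b * (b * v)))"
      using offset_count_odd_sq_add_le[OF b2 q, of r K v] False r yv' by simp
    show ?thesis
    proof (cases "v = 0")
      case True
      \<comment> \<open>For \<open>v = 0\<close> the comparison point is the left end, where count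
        and chord agree; strictness comes from the growth of the chord.\<close>
      have "chord b K (q + 4) 0 < chord b K (q + 4) (real (b * y))"
        using y b2 K1 by (intro chord_strict_mono) auto
      then show ?thesis using le True offset_count_at_0[OF b2, of "q + 4" K] by simp
    next
      case v0: False
      have "real (offset_count b K (q + 4) (b * (b * v))) < chord b K (q + 4) (real (b * (b * v)))"
      proof (cases "b = 2")
        case True
        then show ?thesis using case_2_binary' vd v0 by simp
      next
        case b3: False
        show ?thesis
        proof (cases "b dvd v")
          case True
          then obtain w where w: "v = b * w" by blast
          then have "w \<ge> 1" using v0 by (cases w) auto
          then show ?thesis using case_2_dvd'[of w] b2 b3 vd w by simp
        qed (use case_2_ternary b2 b3 vd v0 in simp)
      qed
      also have "chord b K (q + 4) (real (b * (b * v))) \<le> chord b K (q + 4) (real (b * y))"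
        unfolding yv' using False by (intro chord_mono of_nat_mono mult_le_mono2) simp
      finally show ?thesis using le by simp
    qed
  qed
qed simp

end

end

text \<open>The step reaches back three levels, so levels 1 to 3 start the induction and
  \<open>q = 0\<close> is its first step.\<close>

lemma below_chord:
  assumes "b \<ge> 2" "K \<ge> 1" "m \<ge> 1"
  shows "below_chord b K m"
  using assms(3)
proof (induction m rule: less_induct)
  case (less m)
  consider "m = 1" | "m = 2" | "m = 3" | "m = (m - 4) + 4"
    using less.prems by linarith
  then show ?case
  proof cases
    case 4
    define q where "q = m - 4"
    have m: "m = q + 4" using 4 by (simp add: q_def)
    have "below_chord b K (q + 1)" "below_chord b K (q + 2)" "below_chord b K (q + 3)"
      using less.IH m by simp_all
    then show ?thesis
      unfolding m using below_chord_step_even below_chord_step_odd assms(1,2) by blast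
  qed (use below_chord_1 below_chord_2 below_chord_3 assms in auto)
qed

theorem theorem34:
  fixes b k m n :: nat
  assumes "b \<ge> 2"
    and "2 \<le> m" and "m < k"
    and "G b k m < n" and "n < G b k (m + 1)"
  shows "real (s b n) < J b k m (real n)"
proof -
  define K where "K = k - m"
  have k: "k = m + K" and K1: "K \<ge> 1" using assms by (simp_all add: K_def)
  define x where "x = n - G b k m"
  have n: "n = G b k m + x" using assms by (simp add: x_def)
  have g: "offset b (m + 1) = offset b m + gap b m" using offset_Suc_gap[of b m] assms by simp
  then have gap: "real (G b k (m + 1)) - real (G b k m) = real (gap b m)"
    by (simp add: G_def h_eq_offset)
  have x: "0 < x" "x < gap b m"
    using assms(4,5) n g by (simp_all add: G_def h_eq_offset)
  have "n - 1 = b ^ (m + K) + offset b m + x" "n > 0"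
    using n k by (simp_all add: G_def h_eq_offset)
  then have "s b n = offset_count b K m x"
    using s_eq_expansion_count[of b n] assms by (simp add: offset_count_def)
  also have "real (offset_count b K m x) < chord b K m (real x)"
    using below_chordD_less[OF below_chord[OF assms(1) K1, of m] x] assms by simp
  also have "chord b K m (real x) = J b k m (real n)"
  proof -
    obtain l where l: "m = Suc l" using assms by (cases m) auto
    obtain K' where K': "K = Suc K'" using K1 by (cases K) auto
    \<comment> \<open>The Fibonacci recursion turns \<open>F_(m+1) + (K - 1) F_(m+1) - K F_m\<close>
      into \<open>K F_(m-1)\<close>; \<open>K\<close> is replaced by a successor so that
      \<open>k - (m + 1)\<close> does not truncate.\<close>
    have "real (H k (m + 1)) - real (H k m) = real K * real (fib (m - 1))"
      unfolding H_def k K' l by (simp add: algebra_simps)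
    moreover have "real (H k m) = real (fib (m + 2)) + real K * real (fib m)"
      unfolding H_def k by simp
    ultimately show ?thesis
      unfolding J_def chord_def gap n by simp
  qed
  finally show ?thesis by simp
qed

end
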